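(* Let $1\le r\le s\le t$ and $n=r+s+t+1$. Then $$n+3=r+s+t+4\le D^{f}_{2r+1}(E3C(r,s,t))\le D_{2r+2}(E3C(r,s,t))\le r+s+t+6=n+5.$$
   Context: The exchanged 3-ary $n$-cube $E3C(r,s,t)$ ($r,s,t\ge1$, $n=r+s+t+1$): vertices are strings written $x=ABCd$ with $A\in\{0,1,2\}^r$, $B\in\{0,1,2\}^s$, $C\in\{0,1,2\}^t$, $d\in\{0,1,2\}$. Two distinct vertices $x=ABCd$, $y=A'B'C'd'$ are adjacent iff one of: (E0) $A=A',B=B',C=C'$ and $d\ne d'$; (E1) $d=d'=0$, $A=A'$, $B=B'$ and $C,C'$ differ in exactly one position; (E2) $d=d'=1$, $A=A'$, $C=C'$ and $B,B'$ differ in exactly one position; (E3) $d=d'=2$, $B=B'$, $C=C'$ and $A,A'$ differ in exactly one position. For a connected graph $G$ with vertex connectivity $\kappa(G)$: the $\alpha$-fault diameter ($1\le\alpha\le\kappa(G)-1$) is $D^f_\alpha(G)=\max\{d_{G-F}(u,v): u\ne v,\ F\subseteq V(G)\setminus\{u,v\},\ |F|=\alpha\}$; the $\beta$-wide diameter ($1\le\beta\le\kappa(G)$) $D_\beta(G)$ is the maximum over distinct $u,v$ of the minimum, over all families of $\beta$ pairwise internally disjoint $u$–$v$ paths, of the maximum length of a path in the family. (It is known that $\kappa(E3C(r,s,t))=2r+2$ when $r\le s\le t$.) *)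

theory Defs
  imports Main "HOL-Library.Extended_Nat"
begin

definition gpath :: "'a set \<Rightarrow> ('a \<Rightarrow> 'a \<Rightarrow> bool) \<Rightarrow> 'a list \<Rightarrow> 'a \<Rightarrow> 'a \<Rightarrow> bool" where
  "gpath V E p u v \<longleftrightarrow> p \<noteq> [] \<and> hd p = u \<and> last p = v \<and> distinct p \<and> set p \<subseteq> V \<and>
      (\<forall>i. i + 1 < length p \<longrightarrow> E (p ! i) (p ! (i + 1)))"

definition plen :: "'a list \<Rightarrow> nat" where
  "plen p = length p - 1"

text \<open>Distance in the subgraph induced by V (infinite if no path).\<close>
definition gdist :: "'a set \<Rightarrow> ('a \<Rightarrow> 'a \<Rightarrow> bool) \<Rightarrow> 'a \<Rightarrow> 'a \<Rightarrow> enat" where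
  "gdist V E u v = Inf {enat (plen p) | p. gpath V E p u v}"

definition fault_diam :: "'a set \<Rightarrow> ('a \<Rightarrow> 'a \<Rightarrow> bool) \<Rightarrow> nat \<Rightarrow> enat" where
  "fault_diam V E \<alpha> = Sup {gdist (V - F) E u v | u v F.
      u \<in> V \<and> v \<in> V \<and> u \<noteq> v \<and> F \<subseteq> V - {u, v} \<and> finite F \<and> card F = \<alpha>}"

definition disj_paths :: "'a set \<Rightarrow> ('a \<Rightarrow> 'a \<Rightarrow> bool) \<Rightarrow> nat \<Rightarrow> 'a \<Rightarrow> 'a \<Rightarrow> 'a list set \<Rightarrow> bool" where
  "disj_paths V E \<beta> u v P \<longleftrightarrow> finite P \<and> card P = \<beta> \<and> (\<forall>p\<in>P. gpath V E p u v) \<and>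
      (\<forall>p\<in>P. \<forall>q\<in>P. p \<noteq> q \<longrightarrow> set p \<inter> set q \<subseteq> {u, v})"

definition wide_diam :: "'a set \<Rightarrow> ('a \<Rightarrow> 'a \<Rightarrow> bool) \<Rightarrow> nat \<Rightarrow> enat" where
  "wide_diam V E \<beta> = Sup {Inf {Sup ((\<lambda>p. enat (plen p)) ` P) | P. disj_paths V E \<beta> u v P} | u v.
      u \<in> V \<and> v \<in> V \<and> u \<noteq> v}"

definition tern_words :: "nat \<Rightarrow> nat list set" where
  "tern_words k = {xs. length xs = k \<and> set xs \<subseteq> {0, 1, 2}}"

text \<open>Vertex ABCd is represented as the tuple (A, B, C, d).\<close>
type_synonym e3c_vertex = "nat list \<times> nat list \<times> nat list \<times> nat"

definition E3C_V :: "nat \<Rightarrow> nat \<Rightarrow> nat \<Rightarrow> e3c_vertex set" where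
  "E3C_V r s t = {(A, B, C, d). A \<in> tern_words r \<and> B \<in> tern_words s \<and> C \<in> tern_words t \<and> d \<in> {0, 1, 2}}"

definition differ_one :: "nat list \<Rightarrow> nat list \<Rightarrow> bool" where
  "differ_one X Y \<longleftrightarrow> length X = length Y \<and> card {i. i < length X \<and> X ! i \<noteq> Y ! i} = 1"

definition E3C_E :: "e3c_vertex \<Rightarrow> e3c_vertex \<Rightarrow> bool" where
  "E3C_E x y \<longleftrightarrow> (case (x, y) of ((A, B, C, d), (A', B', C', d')) \<Rightarrow>
      x \<noteq> y \<and>
      ((A = A' \<and> B = B' \<and> C = C' \<and> d \<noteq> d') \<or>
       (d = 0 \<and> d' = 0 \<and> A = A' \<and> B = B' \<and> differ_one C C') \<or>
       (d = 1 \<and> d' = 1 \<and> A = A' \<and> C = C' \<and> differ_one B B') \<or>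
       (d = 2 \<and> d' = 2 \<and> B = B' \<and> C = C' \<and> differ_one A A')))"

end

theory Submission
  imports Defs
begin

text \<open>
  Lower bound: let \<open>u\<close> and \<open>v\<close> lie in layer 2 and differ in every position, and delete all neighbours
  of \<open>u\<close> except one, \<open>w\<close>, that also differs from \<open>v\<close> in every position. Every path from \<open>w\<close> to \<open>v\<close>
  corrects \<open>r + s + t\<close> positions and changes the layer three times.

  Middle inequality: \<open>2r + 1\<close> faults meet at most \<open>2r + 1\<close> of \<open>2r + 2\<close> internally disjoint paths.

  Upper bound: up to permuting the three words and reversing paths, \<open>u = (X, Y, Z, 2)\<close> and
  \<open>v = (X', Y', Z', d)\<close> with \<open>d\<close> 2 or 1. It suffices to confine walks to pairwise disjoint vertex sets.
  For \<open>d = 2\<close> a walk starts at each neighbour \<open>P\<close> of \<open>X\<close>, carries \<open>P\<close> along while it corrects \<open>Y\<close> and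
  then \<open>Z\<close>, and finishes in a fan from the neighbours of \<open>X\<close> to \<open>X'\<close> in the ternary Hamming graph.
  For \<open>d = 1\<close> neighbours \<open>P\<close> of \<open>X\<close> are matched with neighbours \<open>Q\<close> of \<open>Y'\<close>; a walk corrects \<open>Y\<close> to
  \<open>Q\<close> beside \<open>P\<close>, then \<open>Z\<close>, and then \<open>P\<close> to \<open>X'\<close> beside \<open>Q\<close>. The remaining one or two walks make
  a detour through a word \<open>Z1\<close> or \<open>Y1\<close> different from both end values.
\<close>

section \<open>Walks and internally disjoint paths\<close>

text \<open>Walks may repeat vertices, and \<open>k\<close> is only an upper bound for the length,
  because \<open>conn_refl\<close> accepts every \<open>k\<close>. All vertices, the last one
  included, lie in \<open>S\<close>; this confinement is what later yields disjoint paths.\<close>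

inductive conn :: "('a \<Rightarrow> 'a \<Rightarrow> bool) \<Rightarrow> 'a set \<Rightarrow> nat \<Rightarrow> 'a \<Rightarrow> 'a \<Rightarrow> bool" for E S where
  conn_refl: "a \<in> S \<Longrightarrow> conn E S k a a"
| conn_step: "a \<in> S \<Longrightarrow> E a b \<Longrightarrow> conn E S k b c \<Longrightarrow> conn E S (Suc k) a c"

lemma conn_mono:
  assumes "conn E S k a b" "S \<subseteq> T" "k \<le> l"
  shows "conn E T l a b"
  using assms
proof (induction arbitrary: l)
  case (conn_refl a k)
  then show ?case by (auto intro: conn.conn_refl)
next
  case (conn_step a b k c)
  then obtain l' where "l = Suc l'" "k \<le> l'" by (cases l) auto
  with conn_step show ?case by (auto intro: conn.conn_step)
qed

lemma conn_trans:
  assumes "conn E S k a b" "conn E S l b c"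
  shows "conn E S (k + l) a c"
  using assms
proof induction
  case (conn_refl a k)
  then show ?case by (auto intro: conn_mono)
next
  case (conn_step a b k c)
  then show ?case by (auto intro: conn.conn_step)
qed

lemma conn_edge: "a \<in> S \<Longrightarrow> b \<in> S \<Longrightarrow> E a b \<Longrightarrow> conn E S (Suc 0) a b"
  by (auto intro: conn.intros)

lemma conn_map:
  assumes "conn E S k a b" and "\<And>x y. E x y \<Longrightarrow> E' (f x) (f y)" and "f ` S \<subseteq> T"
  shows "conn E' T k (f a) (f b)"
  using assms
proof induction
  case (conn_refl a k)
  then show ?case by (auto intro!: conn.conn_refl)
next
  case (conn_step a b k c)
  then show ?case by (intro conn.conn_step[of "f a" _ _ "f b"]) auto
qed

section \<open>From walks to simple paths\<close>

lemma gpath_Cons: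
  assumes "gpath V E p b v" "E a b" "a \<notin> set p" "a \<in> V"
  shows "gpath V E (a # p) a v"
  using assms unfolding gpath_def
  by (auto simp: nth_Cons hd_conv_nth split: nat.split)

lemma gpath_drop:
  assumes "gpath V E p u v" "i < length p"
  shows "gpath V E (drop i p) (p ! i) v"
  using assms set_drop_subset[of i p] unfolding gpath_def
  by (auto simp: hd_drop_conv_nth)

lemma gpath_mono: "gpath V E p u v \<Longrightarrow> V \<subseteq> W \<Longrightarrow> gpath W E p u v"
  unfolding gpath_def by auto

text \<open>Induction on the walk: a new first vertex is prepended, unless it already occurs on the
  path built so far; then that path is cut off before the occurrence.\<close>

lemma conn_imp_gpath:
  assumes "conn E S k a b"
  shows "\<exists>p. gpath S E p a b \<and> plen p \<le> k"
  using assms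
proof induction
  case (conn_refl a k)
  then have "gpath S E [a] a a" by (auto simp: gpath_def)
  then show ?case by (force simp: plen_def)
next
  case (conn_step a b k c)
  then obtain p where p: "gpath S E p b c" "plen p \<le> k" by auto
  show ?case
  proof (cases "a \<in> set p")
    case True
    then obtain i where i: "i < length p" "p ! i = a" by (auto simp: in_set_conv_nth)
    have "plen (drop i p) \<le> Suc k" using p(2) by (auto simp: plen_def)
    then show ?thesis using gpath_drop[OF p(1) i(1)] i(2) by auto
  next
    case False
    have "plen (a # p) \<le> Suc k" using p by (auto simp: plen_def)
    then show ?thesis using gpath_Cons[OF p(1) \<open>E a b\<close> False \<open>a \<in> S\<close>] by auto
  qed
qed

text \<open>A witness that the inner infimum of \<open>wide_diam\<close> for the pair
  \<open>u\<close>, \<open>v\<close> is at most \<open>k\<close>.\<close>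

definition linkable :: "'a set \<Rightarrow> ('a \<Rightarrow> 'a \<Rightarrow> bool) \<Rightarrow> nat \<Rightarrow> nat \<Rightarrow> 'a \<Rightarrow> 'a \<Rightarrow> bool" where
  "linkable V E n k u v \<longleftrightarrow> (\<exists>P. disj_paths V E n u v P \<and> (\<forall>p\<in>P. plen p \<le> k))"

lemma linkable_mono:
  assumes "linkable V E n k u v" "n' \<le> n"
  shows "linkable V E n' k u v"
proof -
  obtain P where P: "disj_paths V E n u v P" "\<forall>p\<in>P. plen p \<le> k"
    using assms by (auto simp: linkable_def)
  then obtain Q where "Q \<subseteq> P" "card Q = n'" "finite Q"
    using assms(2) obtain_subset_with_card_n[of n' P] by (auto simp: disj_paths_def)
  then have "disj_paths V E n' u v Q"
    using P(1) unfolding disj_paths_def by (meson subsetD)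
  then show ?thesis using P(2) \<open>Q \<subseteq> P\<close> by (auto simp: linkable_def)
qed

lemma gpath_map:
  assumes p: "gpath V E p u v" and inj: "inj_on f V" and V: "f ` V \<subseteq> W"
    and E: "\<And>x y. x \<in> V \<Longrightarrow> y \<in> V \<Longrightarrow> E x y \<Longrightarrow> E' (f x) (f y)"
  shows "gpath W E' (map f p) (f u) (f v)"
proof -
  have "set p \<subseteq> V" using p by (auto simp: gpath_def)
  then have "distinct (map f p)"
    using p inj by (auto simp: gpath_def distinct_map intro: inj_on_subset)
  moreover have "E' (map f p ! i) (map f p ! (i + 1))" if "i + 1 < length (map f p)" for i
  proof -
    have "p ! j \<in> V" if "j < length p" for j using nth_mem[OF that] \<open>set p \<subseteq> V\<close> by blast
    moreover have "E (p ! i) (p ! (i + 1))" using that p by (auto simp: gpath_def)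
    ultimately show ?thesis using that E by auto
  qed
  ultimately show ?thesis
    using p V \<open>set p \<subseteq> V\<close> by (auto simp: gpath_def hd_map last_map)
qed

text \<open>Injectivity keeps the image paths simple and lets them meet only at the images of the
  ends. The intended instances of \<open>f\<close> are \<open>swap12\<close> and
  \<open>swap01\<close>.\<close>

lemma linkable_map:
  assumes L: "linkable V E n k u v" and inj: "inj_on f V" and V: "f ` V \<subseteq> W"
    and uv: "u \<in> V" "v \<in> V"
    and E: "\<And>x y. x \<in> V \<Longrightarrow> y \<in> V \<Longrightarrow> E x y \<Longrightarrow> E' (f x) (f y)"
  shows "linkable W E' n k (f u) (f v)"
proof -
  obtain P where P: "disj_paths V E n u v P" "\<forall>p\<in>P. plen p \<le> k"
    using L by (auto simp: linkable_def)
  have PV: "set p \<subseteq> V" if "p \<in> P" for p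
    using P(1) that by (auto simp: disj_paths_def gpath_def)
  have "inj_on (map f) P"
    by (rule inj_on_mapI, rule inj_on_subset[OF inj]) (use PV in auto)
  then have c: "card (map f ` P) = n" using P(1) by (auto simp: card_image disj_paths_def)
  have d: "set (map f p) \<inter> set (map f q) \<subseteq> {f u, f v}" if "p \<in> P" "q \<in> P" "map f p \<noteq> map f q" for p q
  proof -
    have "p \<noteq> q" using that by auto
    then have "set p \<inter> set q \<subseteq> {u, v}" using P(1) that unfolding disj_paths_def by blast
    moreover have "f ` set p \<inter> f ` set q = f ` (set p \<inter> set q)"
      using inj_on_image_Int[OF inj PV[OF that(1)] PV[OF that(2)]] by simp
    ultimately show ?thesis by auto
  qed
  have "gpath W E' (map f p) (f u) (f v)" if "p \<in> P" for p
    by (rule gpath_map[where E = E, OF _ inj V]) (use P(1) that E in \<open>auto simp: disj_paths_def\<close>)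
  then have "disj_paths W E' n (f u) (f v) (map f ` P)"
    using c d P(1) unfolding disj_paths_def by (simp add: ball_simps)
  moreover have "\<forall>p\<in>map f ` P. plen p \<le> k" using P(2) by (auto simp: plen_def)
  ultimately show ?thesis by (auto simp: linkable_def)
qed

lemma gpath_rev:
  assumes p: "gpath V E p u v" and sym: "\<And>x y. E x y \<Longrightarrow> E y x"
  shows "gpath V E (rev p) v u"
proof -
  have "E (rev p ! i) (rev p ! (i + 1))" if "i + 1 < length (rev p)" for i
  proof -
    define j where "j = length p - Suc (Suc i)"
    have "E (p ! j) (p ! (j + 1))" using p that by (auto simp: gpath_def j_def)
    moreover have "rev p ! i = p ! (j + 1)" "rev p ! (i + 1) = p ! j"
      using that by (auto simp: rev_nth j_def Suc_diff_Suc)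
    ultimately show ?thesis using sym by auto
  qed
  then show ?thesis using p by (auto simp: gpath_def hd_rev last_rev)
qed

lemma linkable_rev:
  assumes L: "linkable V E n k u v" and sym: "\<And>x y. E x y \<Longrightarrow> E y x"
  shows "linkable V E n k v u"
proof -
  obtain P where P: "disj_paths V E n u v P" "\<forall>p\<in>P. plen p \<le> k"
    using L by (auto simp: linkable_def)
  have "card (rev ` P) = n" using P(1) by (auto simp: disj_paths_def card_image)
  moreover have "gpath V E (rev p) v u" if "p \<in> P" for p
    using gpath_rev[where E = E] sym P(1) that by (auto simp: disj_paths_def)
  moreover have "set p \<inter> set q \<subseteq> {v, u}" if "p \<in> P" "q \<in> P" "p \<noteq> q" for p q
    using P(1) that unfolding disj_paths_def by blast
  ultimately have "disj_paths V E n v u (rev ` P)"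
    using P(1) unfolding disj_paths_def by auto
  moreover have "\<forall>p\<in>rev ` P. plen p \<le> k" using P(2) by (auto simp: plen_def)
  ultimately show ?thesis by (auto simp: linkable_def)
qed

text \<open>\<open>S\<close> holds the interior vertices of one path. The first edge is not counted
  in \<open>k\<close>, so the path has length at most \<open>Suc k\<close>.\<close>

definition route :: "('a \<Rightarrow> 'a \<Rightarrow> bool) \<Rightarrow> 'a set \<Rightarrow> 'a \<Rightarrow> 'a \<Rightarrow> nat \<Rightarrow> 'a set \<Rightarrow> bool" where
  "route E V u v k S \<longleftrightarrow> S \<subseteq> V - {u, v} \<and> (\<exists>a\<in>S. E u a \<and> conn E (insert v S) k a v)"

text \<open>The bounding set \<open>U\<close> allows a further route to be added after a single
  disjointness check.\<close>

definition routing :: "('a \<Rightarrow> 'a \<Rightarrow> bool) \<Rightarrow> 'a set \<Rightarrow> 'a \<Rightarrow> 'a \<Rightarrow> nat \<Rightarrow> nat \<Rightarrow> 'a set \<Rightarrow> bool" where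
  "routing E V u v k n U \<longleftrightarrow> (\<exists>\<S>. finite \<S> \<and> card \<S> = n \<and> pairwise disjnt \<S> \<and>
     (\<forall>S\<in>\<S>. route E V u v k S \<and> S \<subseteq> U))"

lemma routing_family:
  assumes "finite I" and "\<And>i. i \<in> I \<Longrightarrow> route E V u v k (S i)"
    and "\<And>i j. i \<in> I \<Longrightarrow> j \<in> I \<Longrightarrow> i \<noteq> j \<Longrightarrow> S i \<inter> S j = {}"
  shows "routing E V u v k (card I) (\<Union>i\<in>I. S i)"
proof -
  \<comment> \<open>Nonempty disjoint sets are distinct, so there are as many sets as
    indices.\<close>
  have "S i \<noteq> {}" if "i \<in> I" for i using assms(2)[OF that] by (auto simp: route_def)
  then have "inj_on S I" using assms(3) by (metis inf.idem inj_onI)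
  then show ?thesis unfolding routing_def
    using assms by (intro exI[of _ "S ` I"]) (auto simp: card_image pairwise_def disjnt_def)
qed

lemma routing_insert:
  assumes "routing E V u v k n U" "route E V u v k S" "S \<inter> U = {}"
  shows "routing E V u v k (Suc n) (U \<union> S)"
proof -
  obtain \<S> where S: "finite \<S>" "card \<S> = n" "pairwise disjnt \<S>"
    "\<forall>S\<in>\<S>. route E V u v k S \<and> S \<subseteq> U"
    using assms(1) unfolding routing_def by auto
  have "S \<noteq> {}" using assms(2) by (auto simp: route_def)
  then have "S \<notin> \<S>" using assms(3) S(4) by blast
  moreover have "pairwise disjnt (insert S \<S>)"
    using S(3,4) assms(3) unfolding pairwise_def disjnt_def by blast
  ultimately show ?thesis unfolding routing_def
    using S assms(2) by (intro exI[of _ "insert S \<S>"]) auto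
qed

text \<open>The last clause gives an interior vertex in \<open>S\<close>. It makes paths from
  disjoint sets distinct and separates them from the single edge \<open>[u, v]\<close>.\<close>

lemma route_imp_gpath:
  assumes "route E V u v k S" "u \<in> V" "v \<in> V" "u \<noteq> v"
  obtains p where "gpath V E p u v" "plen p \<le> Suc k" "set p \<subseteq> insert u (insert v S)" "set p \<inter> S \<noteq> {}"
proof -
  obtain a where a: "a \<in> S" "E u a" "conn E (insert v S) k a v" and S: "S \<subseteq> V - {u, v}"
    using assms(1) by (auto simp: route_def)
  obtain p where p: "gpath (insert v S) E p a v" "plen p \<le> k"
    using conn_imp_gpath[OF a(3)] by auto
  have "set p \<subseteq> insert v S" "a \<in> set p" using p(1) by (auto simp: gpath_def)
  moreover have "u \<notin> set p" using calculation S assms(4) by auto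
  moreover have "gpath V E (u # p) u v"
    using gpath_Cons[where V = V, OF gpath_mono[OF p(1)] a(2)] calculation S assms(2,3) by auto
  moreover have "plen (u # p) \<le> Suc k" using p by (auto simp: plen_def)
  ultimately show ?thesis using a(1) by (intro that[of "u # p"]) auto
qed

lemma routing_imp_linkable:
  assumes R: "routing E V u v k n U" and uv: "u \<in> V" "v \<in> V" "u \<noteq> v"
  shows "linkable V E n (Suc k) u v"
    and "E u v \<Longrightarrow> linkable V E (Suc n) (Suc k) u v"
proof -
  obtain \<S> where S: "finite \<S>" "card \<S> = n" "pairwise disjnt \<S>" "\<And>S. S\<in>\<S> \<Longrightarrow> route E V u v k S"
    using R unfolding routing_def by auto
  have "\<forall>S\<in>\<S>. \<exists>p. gpath V E p u v \<and> plen p \<le> Suc k \<and> set p \<subseteq> insert u (insert v S) \<and> set p \<inter> S \<noteq> {}"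
    using route_imp_gpath[OF S(4) uv] by metis
  then obtain f where f: "\<And>S. S \<in> \<S> \<Longrightarrow> gpath V E (f S) u v"
      "\<And>S. S \<in> \<S> \<Longrightarrow> plen (f S) \<le> Suc k"
      "\<And>S. S \<in> \<S> \<Longrightarrow> set (f S) \<subseteq> insert u (insert v S)"
      "\<And>S. S \<in> \<S> \<Longrightarrow> set (f S) \<inter> S \<noteq> {}"
    by metis
  have Suv: "u \<notin> S" "v \<notin> S" if "S \<in> \<S>" for S using S(4)[OF that] by (auto simp: route_def)
  have int: "set (f S) \<inter> set (f T) \<subseteq> {u, v}" if "S \<in> \<S>" "T \<in> \<S>" "S \<noteq> T" for S T
    using f(3)[OF that(1)] f(3)[OF that(2)] S(3) that unfolding pairwise_def disjnt_def by blast
  have inj: "inj_on f \<S>"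
  proof (rule inj_onI, rule ccontr)
    fix S T assume "S \<in> \<S>" "T \<in> \<S>" "f S = f T" "S \<noteq> T"
    then show False using int[of S T] f(4)[of S] Suv[of S] by auto
  qed
  have P: "disj_paths V E n u v (f ` \<S>)"
    unfolding disj_paths_def
  proof (intro conjI ballI impI)
    fix p q assume "p \<in> f ` \<S>" "q \<in> f ` \<S>" "p \<noteq> q"
    then show "set p \<inter> set q \<subseteq> {u, v}" using int by blast
  qed (use S f(1) inj in \<open>auto simp: card_image\<close>)
  then show "linkable V E n (Suc k) u v" using f(2) unfolding linkable_def by blast
  assume "E u v"
  then have uvp: "gpath V E [u, v] u v" using uv by (auto simp: gpath_def)
  have "[u, v] \<notin> f ` \<S>"
  proof
    assume "[u, v] \<in> f ` \<S>"
    then obtain S where "S \<in> \<S>" "f S = [u, v]" by auto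
    then show False using f(4)[of S] Suv[of S] by (metis Int_commute disjoint_insert(1) inf_bot_right list.set(1) list.simps(15))
  qed
  then have "disj_paths V E (Suc n) u v (insert [u, v] (f ` \<S>))"
    using P uvp S(1) unfolding disj_paths_def by auto
  then show "linkable V E (Suc n) (Suc k) u v" using f(2) unfolding linkable_def
    by (intro exI[of _ "insert [u, v] (f ` \<S>)"]) (auto simp: plen_def)
qed

section \<open>Matchings between finite sets\<close>

lemma matching_exists:
  assumes "finite A" "finite B" "k \<le> card A" "k \<le> card B"
  obtains D \<phi> where "D \<subseteq> A" "card D = k" "finite D" "inj_on \<phi> D" "\<phi> ` D \<subseteq> B"
proof -
  obtain D where D: "D \<subseteq> A" "card D = k" "finite D"
    using obtain_subset_with_card_n[OF assms(3)] by auto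
  obtain C where C: "C \<subseteq> B" "card C = k" "finite C"
    using obtain_subset_with_card_n[OF assms(4)] by auto
  obtain \<phi> where "bij_betw \<phi> D C" using finite_same_card_bij D C by metis
  then show ?thesis using D C that[of D \<phi>] by (auto simp: bij_betw_def)
qed

text \<open>For three distinct rotations of a matching, each forbidden pair occurs in at most one of them.\<close>
lemma matching_avoiding:
  assumes "finite A" "finite B" "k \<le> card A" "k \<le> card B" "3 \<le> k"
  obtains D \<phi> where "D \<subseteq> A" "card D = k" "finite D" "inj_on \<phi> D" "\<phi> ` D \<subseteq> B"
    "\<And>x. x \<in> D \<Longrightarrow> (x, \<phi> x) \<noteq> (a1, b1) \<and> (x, \<phi> x) \<noteq> (a2, b2)"
proof -
  obtain D \<phi> where D: "D \<subseteq> A" "card D = k" "finite D" "inj_on \<phi> D" "\<phi> ` D \<subseteq> B"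
    using matching_exists[OF assms(1-4)] by metis
  obtain f where f: "bij_betw f {0..<k} D" using ex_bij_betw_nat_finite D(2,3) by metis
  define g where "g = the_inv_into {0..<k} f"
  have g: "g x < k" "f (g x) = x" if "x \<in> D" for x
    using f that unfolding g_def bij_betw_def
    by (auto simp: f_the_inv_into_f the_inv_into_f_f)
  \<comment> \<open>Addition of \<open>c\<close> modulo \<open>k\<close>. The shifts by 0, 1 and 2
    differ at every index since \<open>3 \<le> k\<close>.\<close>
  define rot where "rot c i = (if i + c < k then i + c else i + c - k)" for c i
  have rot: "rot c i < k" if "c < 3" "i < k" for c i using that assms(5) by (auto simp: rot_def)
  have rot_inj1: "i = j" if "rot c i = rot c j" "c < 3" "i < k" "j < k" for c i j
    using that by (auto simp: rot_def split: if_splits)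
  have rot_inj2: "c = d" if "rot c i = rot d i" "c < 3" "d < 3" "i < k" for c d i
    using that assms(5) by (auto simp: rot_def split: if_splits)
  have finj: "i = j" if "f i = f j" "i < k" "j < k" for i j
    using f that by (auto simp: bij_betw_def inj_on_def)
  have fD: "f i \<in> D" if "i < k" for i using f that by (auto simp: bij_betw_def)
  define \<psi> where "\<psi> c x = \<phi> (f (rot c (g x)))" for c x
  have \<psi>D: "f (rot c (g x)) \<in> D" if "c < 3" "x \<in> D" for c x
    using that rot g fD by blast
  have \<psi>_inj: "inj_on (\<psi> c) D" if "c < 3" for c
  proof (rule inj_onI)
    fix x y assume xy: "x \<in> D" "y \<in> D" "\<psi> c x = \<psi> c y"
    then have "f (rot c (g x)) = f (rot c (g y))"
      using D(4) \<psi>D that by (auto simp: \<psi>_def inj_on_def)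
    then have "g x = g y" using finj rot rot_inj1 that xy g by metis
    then show "x = y" using g xy by metis
  qed
  have once: "c = d" if "x \<in> D" "\<psi> c x = \<psi> d x" "c < 3" "d < 3" for c d x
  proof -
    have "f (rot c (g x)) = f (rot d (g x))"
      using that D(4) \<psi>D by (auto simp: \<psi>_def inj_on_def)
    then show ?thesis using finj rot rot_inj2 that g by metis
  qed
  \<comment> \<open>By \<open>once\<close>, each of the two forbidden pairs rules out at most one of
    the three shifts.\<close>
  have "\<exists>c<3. \<forall>x\<in>D. (x, \<psi> c x) \<noteq> (a1, b1) \<and> (x, \<psi> c x) \<noteq> (a2, b2)"
  proof (rule ccontr)
    assume "\<not> ?thesis"
    then have bad: "(a1 \<in> D \<and> \<psi> c a1 = b1) \<or> (a2 \<in> D \<and> \<psi> c a2 = b2)" if "c < 3" for c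
      using that by auto
    show False
      using bad[of 0] bad[of 1] bad[of 2] once[of a1 0 1] once[of a1 0 2] once[of a1 1 2]
        once[of a2 0 1] once[of a2 0 2] once[of a2 1 2] by auto
  qed
  then obtain c where c: "c < 3" "\<forall>x\<in>D. (x, \<psi> c x) \<noteq> (a1, b1) \<and> (x, \<psi> c x) \<noteq> (a2, b2)" by auto
  have "\<psi> c ` D \<subseteq> B" using D(5) \<psi>D[OF c(1)] by (auto simp: \<psi>_def)
  then show ?thesis using that[of D "\<psi> c"] D \<psi>_inj c by auto
qed

section \<open>Comparison of fault diameter and wide diameter\<close>

lemma fault_diam_le_wide_diam: "fault_diam V E n \<le> wide_diam V E (Suc n)"
  unfolding fault_diam_def
proof (rule Sup_least, clarify)
  fix u v F
  assume uv: "u \<in> V" "v \<in> V" "u \<noteq> v" and F: "F \<subseteq> V - {u, v}" "finite F" "n = card F"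
  have "gdist (V - F) E u v \<le> Sup ((\<lambda>p. enat (plen p)) ` P)"
    if P: "disj_paths V E (Suc n) u v P" for P
  proof -
    have "\<exists>p\<in>P. set p \<inter> F = {}"
    proof (rule ccontr)
      assume "\<not> (\<exists>p\<in>P. set p \<inter> F = {})"
      then have "\<forall>p\<in>P. \<exists>x. x \<in> set p \<inter> F" by blast
      \<comment> \<open>A fault chosen on each path: faults are interior vertices, so different
        paths get different faults, and \<open>Suc n\<close> paths would need more than
        \<open>n\<close> of them.\<close>
      then obtain g where g: "\<And>p. p \<in> P \<Longrightarrow> g p \<in> set p \<inter> F" by metis
      have "inj_on g P"
      proof (rule inj_onI, rule ccontr)
        fix p q assume "p \<in> P" "q \<in> P" "g p = g q" "p \<noteq> q"
        moreover from this have "set p \<inter> set q \<subseteq> {u, v}" using P unfolding disj_paths_def by blast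
        ultimately show False using g[of p] g[of q] F(1) by auto
      qed
      then have "card P \<le> card F" using g F(2) by (intro card_inj_on_le[of g]) auto
      then show False using P F(3) by (auto simp: disj_paths_def)
    qed
    then obtain p where p: "p \<in> P" "set p \<inter> F = {}" by auto
    then have "gpath (V - F) E p u v" using P by (auto simp: disj_paths_def gpath_def)
    then have "gdist (V - F) E u v \<le> enat (plen p)"
      unfolding gdist_def by (auto intro: Inf_lower)
    also have "\<dots> \<le> Sup ((\<lambda>p. enat (plen p)) ` P)" using p by (auto intro: Sup_upper)
    finally show ?thesis .
  qed
  then have "gdist (V - F) E u v \<le> Inf {Sup ((\<lambda>p. enat (plen p)) ` P) | P. disj_paths V E (Suc n) u v P}"
    by (auto intro!: Inf_greatest)
  also have "\<dots> \<le> wide_diam V E (Suc n)"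
    unfolding wide_diam_def using uv by (intro Sup_upper) auto
  finally show "gdist (V - F) E u v \<le> wide_diam V E (Suc (card F))" using F(3) by simp
qed

lemma wide_diam_le:
  assumes "\<And>u v. u \<in> V \<Longrightarrow> v \<in> V \<Longrightarrow> u \<noteq> v \<Longrightarrow> linkable V E n k u v"
  shows "wide_diam V E n \<le> enat k"
  unfolding wide_diam_def
proof (rule Sup_least, clarify)
  fix u v assume "u \<in> V" "v \<in> V" "u \<noteq> v"
  then obtain P where P: "disj_paths V E n u v P" "\<forall>p\<in>P. plen p \<le> k"
    using assms unfolding linkable_def by blast
  have "Inf {Sup ((\<lambda>p. enat (plen p)) ` P) | P. disj_paths V E n u v P} \<le> Sup ((\<lambda>p. enat (plen p)) ` P)"
    using P by (auto intro: Inf_lower)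
  also have "\<dots> \<le> enat k" using P(2) by (auto intro!: Sup_least)
  finally show "Inf {Sup ((\<lambda>p. enat (plen p)) ` P) | P. disj_paths V E n u v P} \<le> enat k" .
qed

section \<open>Ternary words\<close>

definition ham :: "'a list \<Rightarrow> 'a list \<Rightarrow> nat" where
  "ham X Y = card {i. i < length X \<and> X ! i \<noteq> Y ! i}"

lemma ham_le_length: "ham X Y \<le> length X"
  unfolding ham_def using card_mono[of "{..<length X}" "{i. i < length X \<and> X ! i \<noteq> Y ! i}"] by auto

lemma ham_eq_0: "length X = length Y \<Longrightarrow> ham X Y = 0 \<longleftrightarrow> X = Y"
  unfolding ham_def by (auto simp: list_eq_iff_nth_eq)

lemma ham_self [simp]: "ham X X = 0"
  by (simp add: ham_def)

lemma ham_triangle: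
  assumes "length X = length Y"
  shows "ham X Z \<le> ham X Y + ham Y Z"
proof -
  have "ham X Z \<le> card ({i. i < length X \<and> X ! i \<noteq> Y ! i} \<union> {i. i < length Y \<and> Y ! i \<noteq> Z ! i})"
    unfolding ham_def using assms by (intro card_mono) auto
  also have "\<dots> \<le> ham X Y + ham Y Z" unfolding ham_def by (rule card_Un_le)
  finally show ?thesis .
qed

lemma differ_one_iff_ham: "differ_one X Y \<longleftrightarrow> length X = length Y \<and> ham X Y = 1"
  by (simp add: differ_one_def ham_def)

lemma differ_one_sym: "differ_one X Y \<Longrightarrow> differ_one Y X"
  unfolding differ_one_def by (auto simp: eq_commute[of "Y ! _"])

lemma differ_one_irrefl [simp]: "\<not> differ_one X X"
  by (simp add: differ_one_def)

lemma differ_one_update: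
  assumes "i < length X" "c \<noteq> X ! i"
  shows "differ_one X (X[i := c])"
proof -
  have "{j. j < length X \<and> X ! j \<noteq> X[i := c] ! j} = {i}"
    using assms by (auto simp: nth_list_update)
  then show ?thesis by (simp add: differ_one_def)
qed

lemma differ_oneE:
  assumes "differ_one X Y"
  obtains i c where "i < length X" "c \<noteq> X ! i" "Y = X[i := c]"
proof -
  have l: "length X = length Y" and "card {i. i < length X \<and> X ! i \<noteq> Y ! i} = 1"
    using assms by (auto simp: differ_one_def)
  then obtain i where i: "{i. i < length X \<and> X ! i \<noteq> Y ! i} = {i}"
    by (auto simp: card_1_singleton_iff)
  then have "X ! p = Y ! p" if "p < length X" "p \<noteq> i" for p using that by blast
  moreover have "i < length X" "Y ! i \<noteq> X ! i" using i by force+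
  ultimately have "Y = X[i := Y ! i]"
    using l by (intro nth_equalityI) (auto simp: nth_list_update)
  then show ?thesis using \<open>i < length X\<close> \<open>Y ! i \<noteq> X ! i\<close> by (rule that[rotated 2])
qed

lemma tern_words_length: "X \<in> tern_words k \<Longrightarrow> length X = k"
  by (simp add: tern_words_def)

lemma tern_words_nth: "X \<in> tern_words k \<Longrightarrow> i < k \<Longrightarrow> X ! i \<in> {0, 1, 2}"
  unfolding tern_words_def by (metis (mono_tags, lifting) mem_Collect_eq nth_mem subsetD)

lemma tern_words_iff: "X \<in> tern_words k \<longleftrightarrow> length X = k \<and> (\<forall>i<k. X ! i \<in> {0, 1, 2})"
  unfolding tern_words_def by (auto simp: in_set_conv_nth subset_iff)

lemma tern_words_update: "X \<in> tern_words k \<Longrightarrow> c \<in> {0, 1, 2} \<Longrightarrow> X[i := c] \<in> tern_words k"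
  unfolding tern_words_def using set_update_subset_insert[of X i c] by auto

lemma finite_tern_words: "finite (tern_words k)"
  unfolding tern_words_def using finite_lists_length_eq[of "{0, 1, 2 :: nat}" k] by (simp add: conj_commute)

text \<open>For words of equal length this is the interval between \<open>X\<close> and
  \<open>Y\<close> in the Hamming graph: the words met when each differing letter is changed
  directly to its final value.\<close>

definition box :: "'a list \<Rightarrow> 'a list \<Rightarrow> 'a list set" where
  "box X Y = {W. length W = length X \<and> (\<forall>i<length X. W ! i = X ! i \<or> W ! i = Y ! i)}"

lemma box_subset_tern_words: "X \<in> tern_words k \<Longrightarrow> Y \<in> tern_words k \<Longrightarrow> box X Y \<subseteq> tern_words k"
proof
  fix W assume "X \<in> tern_words k" "Y \<in> tern_words k" "W \<in> box X Y"
  then have "length W = k" "\<forall>i<k. X ! i \<in> {0, 1, 2}" "\<forall>i<k. Y ! i \<in> {0, 1, 2}"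
    "\<forall>i<k. W ! i = X ! i \<or> W ! i = Y ! i"
    by (simp_all add: box_def tern_words_iff)
  then show "W \<in> tern_words k" unfolding tern_words_iff by metis
qed

text \<open>One differing position is corrected per step, which stays in the box. The map
  \<open>f\<close> places the words in a larger graph, for instance in one layer of the cube with
  the other two words fixed.\<close>

lemma conn_ham:
  assumes "length X = length Y" and "f ` box X Y \<subseteq> S"
    and E: "\<And>W W'. differ_one W W' \<Longrightarrow> E (f W) (f W')"
  shows "conn E S (ham X Y) (f X) (f Y)"
  using assms(1,2)
proof (induction "ham X Y" arbitrary: X)
  case 0
  then have "X = Y" using ham_eq_0 by metis
  then show ?case using 0 by (auto intro!: conn_refl simp: box_def)
next
  case (Suc n)
  then obtain i where i: "i < length X" "X ! i \<noteq> Y ! i"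
    by (metis ham_eq_0 list_eq_iff_nth_eq nat.distinct(1))
  define W where "W = X[i := Y ! i]"
  have "{j. j < length X \<and> X ! j \<noteq> Y ! j} = insert i {j. j < length W \<and> W ! j \<noteq> Y ! j}"
    using i by (auto simp: W_def nth_list_update)
  then have "ham X Y = Suc (ham W Y)" unfolding ham_def by (auto simp: W_def nth_list_update i)
  then have n: "n = ham W Y" using Suc by simp
  have b: "box W Y \<subseteq> box X Y" unfolding box_def W_def
    using i(1) by (auto simp: nth_list_update)
  have "conn E S n (f W) (f Y)"
    unfolding n by (rule Suc(1)[OF n]) (use Suc b in \<open>auto simp: W_def\<close>)
  moreover have "E (f X) (f W)" using E differ_one_update[OF i(1)] i(2) by (auto simp: W_def)
  moreover have "f X \<in> S" using Suc by (auto simp: box_def)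
  ultimately show ?case unfolding Suc(2)[symmetric] by (intro conn_step)
qed

definition nbrs :: "nat \<Rightarrow> nat list \<Rightarrow> nat list set" where
  "nbrs k X = {P \<in> tern_words k. differ_one X P}"

lemma finite_nbrs [simp]: "finite (nbrs k X)"
  by (simp add: nbrs_def finite_tern_words)

text \<open>A neighbour is determined by one of \<open>k\<close> positions and one of the two other
  letters there.\<close>

lemma card_nbrs:
  assumes X: "X \<in> tern_words k"
  shows "card (nbrs k X) = 2 * k"
proof -
  let ?I = "SIGMA i:{..<k}. {0, 1, 2} - {X ! i}"
  have l: "length X = k" using X tern_words_length by auto
  have "nbrs k X = (\<lambda>(i, c). X[i := c]) ` ?I"
  proof
    show "nbrs k X \<subseteq> (\<lambda>(i, c). X[i := c]) ` ?I"
    proof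
      fix P assume P: "P \<in> nbrs k X"
      then obtain i c where ic: "i < length X" "c \<noteq> X ! i" "P = X[i := c]"
        by (auto simp: nbrs_def elim: differ_oneE)
      then have "c \<in> {0, 1, 2}"
        using P l tern_words_nth[of P k i] by (auto simp: nbrs_def)
      then show "P \<in> (\<lambda>(i, c). X[i := c]) ` ?I" using ic l by force
    qed
    show "(\<lambda>(i, c). X[i := c]) ` ?I \<subseteq> nbrs k X"
      using X l differ_one_update tern_words_update unfolding nbrs_def by auto
  qed
  moreover have "inj_on (\<lambda>(i, c). X[i := c]) ?I"
  proof (rule inj_onI)
    fix x y assume *: "x \<in> ?I" "y \<in> ?I" "(\<lambda>(i, c). X[i := c]) x = (\<lambda>(i, c). X[i := c]) y"
    obtain i c j e where xy: "x = (i, c)" "y = (j, e)" by (cases x, cases y)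
    have "X[j := e] ! i = c" using * l unfolding xy by (metis (no_types, lifting) SigmaD1 lessThan_iff nth_list_update_eq split_conv)
    then show "x = y" using * l unfolding xy by (auto simp: nth_list_update split: if_splits)
  qed
  moreover have "card ?I = 2 * k"
  proof -
    have "card ({0, 1, 2} - {X ! i}) = 2" if "i < k" for i
      using tern_words_nth[OF X that] by (auto simp: card_Diff_singleton)
    then show ?thesis by (simp add: card_SigmaI)
  qed
  ultimately show ?thesis by (simp add: card_image)
qed

definition clnbrs :: "nat \<Rightarrow> nat list \<Rightarrow> nat list set" where
  "clnbrs k X = insert X (nbrs k X)"

lemma card_clnbrs: "X \<in> tern_words k \<Longrightarrow> card (clnbrs k X) = Suc (2 * k)"
  using card_nbrs[of X k] by (simp add: clnbrs_def card_insert_if) (simp add: nbrs_def)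

lemma clnbrs_subset: "X \<in> tern_words k \<Longrightarrow> clnbrs k X \<subseteq> tern_words k"
  by (auto simp: clnbrs_def nbrs_def)

lemma third_letter: "\<exists>c\<in>{0, 1, 2}. c \<noteq> a \<and> c \<noteq> (b::nat)"
proof (rule ccontr)
  assume "\<not> ?thesis"
  then have "{0, 1, 2} \<subseteq> {a, b}" by auto
  then have "card {0, 1, 2::nat} \<le> card {a, b}" by (intro card_mono) auto
  then show False using card_insert_le_m1[of 2 "{b}" a] by simp
qed

text \<open>\<open>Z1\<close> is \<open>Z'\<close> with its letter at position 0 replaced by one
  that differs from both \<open>Z ! 0\<close> and \<open>Z' ! 0\<close>. Reaching it costs at most
  \<open>k\<close> steps, and \<open>Z'\<close> is one step further.\<close>

lemma detour_word:
  assumes "Z \<in> tern_words k" "Z' \<in> tern_words k" "1 \<le> k"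
  obtains Z1 where "Z1 \<in> tern_words k" "Z1 \<noteq> Z" "Z1 \<noteq> Z'" "ham Z Z1 + ham Z1 Z' \<le> Suc k"
proof -
  obtain c where c: "c \<in> {0, 1, 2}" "c \<noteq> Z ! 0" "c \<noteq> Z' ! 0" using third_letter by blast
  define Z1 where "Z1 = Z'[0 := c]"
  have l: "length Z = k" "length Z' = k" using assms tern_words_length by auto
  have "Z1 ! 0 = c" using l assms(3) by (simp add: Z1_def)
  moreover have "differ_one Z' Z1" using differ_one_update[of 0 Z' c] c l assms(3) by (simp add: Z1_def)
  then have "ham Z1 Z' = 1" using differ_one_sym differ_one_iff_ham by blast
  moreover have "ham Z Z1 \<le> k" using ham_le_length[of Z Z1] l by simp
  ultimately show ?thesis
    using c tern_words_update[OF assms(2) c(1), of 0] by (intro that[of Z1]) (auto simp: Z1_def)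
qed

section \<open>Correcting letters in cyclic order\<close>

definition cdist :: "nat \<Rightarrow> nat \<Rightarrow> nat \<Rightarrow> nat" where
  "cdist k i p = (if i \<le> p then p - i else p + k - i)"

text \<open>Stage \<open>l\<close> of the walk from \<open>X\<close> to \<open>Y\<close> that
  corrects the positions cyclically from \<open>i\<close> on.\<close>

definition cmix :: "nat \<Rightarrow> 'a list \<Rightarrow> 'a list \<Rightarrow> nat \<Rightarrow> nat \<Rightarrow> 'a list" where
  "cmix k X Y i l = map (\<lambda>p. if cdist k i p < l then Y ! p else X ! p) [0..<k]"

lemma cmix_nth [simp]: "p < k \<Longrightarrow> cmix k X Y i l ! p = (if cdist k i p < l then Y ! p else X ! p)"
  by (simp add: cmix_def)

lemma length_cmix [simp]: "length (cmix k X Y i l) = k"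
  by (simp add: cmix_def)

lemma cmix_full: "length Y = k \<Longrightarrow> i < k \<Longrightarrow> cmix k X Y i k = Y"
  by (intro nth_equalityI) (auto simp: cdist_def)

lemma cmix_1: "length X = k \<Longrightarrow> i < k \<Longrightarrow> cmix k X Y i 1 = X[i := Y ! i]"
  by (intro nth_equalityI) (auto simp: cdist_def nth_list_update)

text \<open>The common word agrees with \<open>Y\<close> at \<open>i\<close> and at
  \<open>j\<close>, where \<open>X\<close> and \<open>Y\<close> differ. So the corrected arc from
  \<open>i\<close> reaches \<open>j\<close> and the one from \<open>j\<close> reaches
  \<open>i\<close>, and together they cover the cycle.\<close>

lemma cmix_eq_full:
  assumes eq: "cmix k X Y i l = cmix k X Y j m" and Y: "length Y = k"
    and ij: "i < k" "j < k" "i \<noteq> j" and d: "X ! i \<noteq> Y ! i" "X ! j \<noteq> Y ! j" and lm: "1 \<le> l" "1 \<le> m"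
  shows "cmix k X Y i l = Y"
proof (rule nth_equalityI)
  have eqn: "cmix k X Y i l ! p = cmix k X Y j m ! p" for p using eq by simp
  have 1: "cdist k j i < m" using eqn[of i] ij d lm by (auto simp: cdist_def split: if_splits)
  have 2: "cdist k i j < l" using eqn[of j] ij d lm by (auto simp: cdist_def split: if_splits)
  fix p assume "p < length (cmix k X Y i l)"
  then have p: "p < k" by simp
  have "cdist k i p \<le> cdist k i j \<or> cdist k j p \<le> cdist k j i"
    using p ij by (auto simp: cdist_def)
  then have "cdist k i p < l \<or> cdist k j p < m" using 1 2 by linarith
  then show "cmix k X Y i l ! p = Y ! p" using eqn[of p] p by auto
qed (use Y in simp)

lemma cmix_step:
  assumes "length X = k" "i < k"
  shows "cmix k X Y i (Suc l) = cmix k X Y i l \<or> differ_one (cmix k X Y i l) (cmix k X Y i (Suc l))"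
proof (cases "l < k")
  case True
  \<comment> \<open>The only position at cyclic distance \<open>l\<close> from \<open>i\<close>,
    hence the only one where stages \<open>l\<close> and \<open>Suc l\<close> can differ.\<close>
  define q where "q = (if i + l < k then i + l else i + l - k)"
  have q: "q < k" "cdist k i q = l" using True assms by (auto simp: q_def cdist_def)
  have u: "p = q" if "p < k" "cdist k i p = l" for p
    using that True assms by (auto simp: q_def cdist_def split: if_splits)
  have eq: "cmix k X Y i (Suc l) = (cmix k X Y i l)[q := Y ! q]"
  proof (rule nth_equalityI)
    fix p assume "p < length (cmix k X Y i (Suc l))"
    then have p: "p < k" by simp
    show "cmix k X Y i (Suc l) ! p = (cmix k X Y i l)[q := Y ! q] ! p"
    proof (cases "p = q")
      case True
      then show ?thesis using q by simp
    next
      case False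
      then have "cdist k i p \<noteq> l" using u p by blast
      then show ?thesis using False p by simp
    qed
  qed simp
  show ?thesis
  proof (cases "Y ! q = cmix k X Y i l ! q")
    case True
    then show ?thesis using eq by (metis list_update_id)
  next
    case False
    then show ?thesis using eq differ_one_update[of q "cmix k X Y i l" "Y ! q"] q by auto
  qed
next
  case False
  have "cdist k i p < l" if "p < k" for p using that False assms by (auto simp: cdist_def)
  then show ?thesis by (intro disjI1 nth_equalityI) (auto simp: less_SucI)
qed

text \<open>Induction downwards from stage \<open>k\<close>, where the word is \<open>Y\<close>; a
  stage that changes no letter costs no step.\<close>

lemma conn_cmix:
  assumes X: "length X = k" and Y: "length Y = k" and i: "i < k" and l: "1 \<le> l" "l \<le> k"
    and E: "\<And>W W'. differ_one W W' \<Longrightarrow> E W W'"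
    and S: "\<And>l. 1 \<le> l \<Longrightarrow> cmix k X Y i l \<in> S"
  shows "conn E S (k - l) (cmix k X Y i l) Y"
  using l(2,1)
proof (induction l rule: inc_induct)
  case base
  then show ?case using cmix_full[OF Y i, of X] S[of k] by (auto intro!: conn_refl)
next
  case (step l)
  then have c: "conn E S (k - Suc l) (cmix k X Y i (Suc l)) Y" by simp
  show ?case
  proof (cases "cmix k X Y i (Suc l) = cmix k X Y i l")
    case True
    then show ?thesis using c by (auto intro: conn_mono)
  next
    case False
    then have "E (cmix k X Y i l) (cmix k X Y i (Suc l))"
      using cmix_step[OF X i, of Y l] E by auto
    then have "conn E S (Suc (k - Suc l)) (cmix k X Y i l) Y"
      using c S step by (intro conn_step) auto
    then show ?thesis using step by (simp add: Suc_diff_Suc)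
  qed
qed

text \<open>The fan from the neighbours of \<open>X\<close> to \<open>Y\<close> in the Hamming graph. A neighbour \<open>X[i := c]\<close>
  with \<open>c \<noteq> Y ! i\<close> keeps the letter \<open>c\<close> until its last step, and \<open>X[i := Y ! i]\<close> corrects the
  positions in cyclic order starting at \<open>i\<close>.\<close>
definition fan :: "nat \<Rightarrow> nat list \<Rightarrow> nat list \<Rightarrow> nat list \<Rightarrow> nat list set" where
  "fan k X Y P =
     (\<Union>i\<in>{i. i < k \<and> P ! i \<noteq> X ! i}.
        if P ! i = Y ! i then {cmix k X Y i l |l. 1 \<le> l} - {Y}
        else {W. length W = k \<and> W ! i = P ! i \<and> (\<forall>p<k. p \<noteq> i \<longrightarrow> W ! p \<in> {X ! p, Y ! p})})"

text \<open>For a neighbour of \<open>X\<close> the union in \<open>fan\<close> runs over the single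
  changed position.\<close>

lemma fan_update:
  assumes "length X = k" "i < k" "c \<noteq> X ! i"
  shows "fan k X Y (X[i := c]) =
    (if c = Y ! i then {cmix k X Y i l |l. 1 \<le> l} - {Y}
     else {W. length W = k \<and> W ! i = c \<and> (\<forall>p<k. p \<noteq> i \<longrightarrow> W ! p \<in> {X ! p, Y ! p})})"
proof -
  have "{j. j < k \<and> X[i := c] ! j \<noteq> X ! j} = {i}" using assms by (auto simp: nth_list_update)
  then show ?thesis using assms by (simp add: fan_def)
qed

text \<open>Disjointness: if \<open>c\<close> is neither \<open>X ! i\<close> nor
  \<open>Y ! i\<close>, the position and value of this foreign letter identify the neighbour. Words
  on the cyclic walks have no foreign letter, and two such walks can share only \<open>Y\<close> by
  \<open>cmix_eq_full\<close>, which is removed.\<close>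

lemma fan_properties:
  assumes X: "X \<in> tern_words k" and Y: "Y \<in> tern_words k" and P: "P \<in> nbrs k X"
  shows "fan k X Y P \<subseteq> tern_words k" "X \<notin> fan k X Y P" "Y \<notin> fan k X Y P"
    and "(\<And>W W'. differ_one W W' \<Longrightarrow> E W W') \<Longrightarrow> conn E (insert Y (fan k X Y P)) k P Y"
    and "Q \<in> nbrs k X \<Longrightarrow> P \<noteq> Q \<Longrightarrow> fan k X Y P \<inter> fan k X Y Q = {}"
    and "P \<noteq> Y \<Longrightarrow> P \<in> fan k X Y P"
proof -
  have l: "length X = k" "length Y = k" using X Y tern_words_length by auto
  obtain i c where ic: "i < k" "c \<noteq> X ! i" "P = X[i := c]"
    using P l by (auto simp: nbrs_def elim: differ_oneE)
  have c: "c \<in> {0, 1, 2}" using P ic l tern_words_nth[of P k i] by (auto simp: nbrs_def)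
  note fP = fan_update[OF l(1) ic(1,2), of Y, folded ic(3)]
  show "fan k X Y P \<subseteq> tern_words k"
  proof
    fix W assume W: "W \<in> fan k X Y P"
    then have "length W = k" by (auto simp: fP split: if_splits)
    moreover have "W ! p \<in> {0, 1, 2}" if p: "p < k" for p
    proof -
      have "W ! p \<in> {X ! p, Y ! p, c}" using W p by (cases "p = i") (auto simp: fP split: if_splits)
      then show ?thesis using c tern_words_nth[OF X p] tern_words_nth[OF Y p] by auto
    qed
    ultimately show "W \<in> tern_words k" by (simp add: tern_words_iff)
  qed
  show "X \<notin> fan k X Y P"
  proof
    assume "X \<in> fan k X Y P"
    moreover have "cmix k X Y i l ! i = Y ! i" if "1 \<le> l" for l
      using ic that by (simp add: cdist_def)
    ultimately have "X ! i = c" unfolding fP by (auto simp del: cmix_nth split: if_splits) metis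
    then show False using ic by simp
  qed
  show "Y \<notin> fan k X Y P" using fP by auto
  show Pin: "P \<in> fan k X Y P" if "P \<noteq> Y"
  proof (cases "c = Y ! i")
    case True
    then have "P = cmix k X Y i 1" using cmix_1[OF l(1) ic(1)] ic by auto
    then show ?thesis using True that unfolding fP by auto
  next
    case False
    then show ?thesis unfolding fP using ic l by (auto simp: nth_list_update)
  qed
  show "conn E (insert Y (fan k X Y P)) k P Y" if E: "\<And>W W'. differ_one W W' \<Longrightarrow> E W W'"
  proof (cases "c = Y ! i")
    case True
    then have "P = cmix k X Y i 1" using cmix_1[OF l(1) ic(1)] ic by auto
    moreover have "conn E (insert Y (fan k X Y P)) (k - 1) (cmix k X Y i 1) Y"
      by (rule conn_cmix[OF l ic(1)]) (use True ic(1) E in \<open>auto simp: fP\<close>)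
    ultimately show ?thesis by (auto intro: conn_mono)
  next
    case False
    \<comment> \<open>The last word before \<open>Y\<close>: at most \<open>k - 1\<close> other
      positions are corrected first, and the foreign letter \<open>c\<close> last.\<close>
    define W where "W = Y[i := c]"
    have lW: "length P = length W" by (simp add: W_def ic l)
    have b: "box P W \<subseteq> insert Y (fan k X Y P)"
      unfolding fP box_def W_def using False ic l by (auto simp: nth_list_update)
    have c1: "conn E (insert Y (fan k X Y P)) (ham P W) P W"
      using conn_ham[OF lW, where f = "\<lambda>x. x"] b E by auto
    have h: "ham P W \<le> k - 1"
    proof -
      have "{j. j < length P \<and> P ! j \<noteq> W ! j} \<subseteq> {..<k} - {i}" using ic l by (auto simp: W_def)
      then have "ham P W \<le> card ({..<k} - {i})" unfolding ham_def by (intro card_mono) auto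
      then show ?thesis using ic by simp
    qed
    have c2: "conn E (insert Y (fan k X Y P)) 1 W Y"
    proof -
      have "differ_one Y W" using differ_one_update[of i Y c] False ic l by (auto simp: W_def)
      then have "E W Y" using E differ_one_sym by auto
      moreover have "W \<in> box P W" by (auto simp: box_def lW)
      ultimately show ?thesis using b by (auto intro: conn_edge)
    qed
    show ?thesis by (rule conn_mono[OF conn_trans[OF c1 c2] order_refl]) (use h ic(1) in linarith)
  qed
  show "fan k X Y P \<inter> fan k X Y Q = {}" if Q: "Q \<in> nbrs k X" "P \<noteq> Q"
  proof -
    obtain j e where je: "j < k" "e \<noteq> X ! j" "Q = X[j := e]"
      using Q l by (auto simp: nbrs_def elim: differ_oneE)
    note fQ = fan_update[OF l(1) je(1,2), of Y, folded je(3)]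
    have ne: "i \<noteq> j \<or> c \<noteq> e" using Q ic je by auto
    have False if W: "W \<in> fan k X Y P" "W \<in> fan k X Y Q" for W
    proof -
      have m: "cmix k X Y a m ! p \<in> {X ! p, Y ! p}" if "p < k" for a m p using that by auto
      show False
      proof (cases "c = Y ! i")
        case True
        then obtain a where a: "W = cmix k X Y i a" "1 \<le> a" "W \<noteq> Y" using W fP by auto
        show False
        proof (cases "e = Y ! j")
          case True
          then obtain b where b: "W = cmix k X Y j b" "1 \<le> b" using W fQ by auto
          have "i \<noteq> j" using ne \<open>c = Y ! i\<close> True by auto
          then show False
            using cmix_eq_full[of k X Y i a j b] a b l ic je True \<open>c = Y ! i\<close> by auto
        next
          case False
          then show False using W fQ m[of j i a] a je by auto
        qed
      next
        case False
        then have w: "W ! i = c" "\<forall>p<k. p \<noteq> i \<longrightarrow> W ! p \<in> {X ! p, Y ! p}" using W fP by auto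
        show False
        proof (cases "e = Y ! j")
          case True
          then obtain b where b: "W = cmix k X Y j b" using W fQ by auto
          then show False using m[of i j b] w False ic by auto
        next
          case False
          then have w': "W ! j = e" "\<forall>p<k. p \<noteq> j \<longrightarrow> W ! p \<in> {X ! p, Y ! p}" using W fQ by auto
          then show False using w ne ic je False \<open>c \<noteq> Y ! i\<close> by (cases "i = j") auto
        qed
      qed
    qed
    then show ?thesis by auto
  qed
qed

text \<open>For \<open>Y \<noteq> Y'\<close>, \<open>Q\<close> is \<open>Y'\<close> with the letter
  of \<open>Y\<close> kept at one position where they differ. All words of \<open>box Y Q\<close>
  have this letter there, but among the closed neighbours of \<open>Y'\<close> only \<open>Q\<close>
  does. So a walk from \<open>Y\<close> to \<open>Q\<close> inside the box meets that neighbourhood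
  only at its end.\<close>

lemma last_letter_word:
  assumes Y: "Y \<in> tern_words k" and Y': "Y' \<in> tern_words k"
  obtains Q where "Q \<in> clnbrs k Y'" "box Y Q \<inter> clnbrs k Y' = {Q}"
    "Y = Y' \<longleftrightarrow> Q = Y'"
proof (cases "Y = Y'")
  case True
  then have "box Y Y' = {Y'}" unfolding box_def by (auto simp: list_eq_iff_nth_eq)
  then show ?thesis using that[of Y'] True by (auto simp: clnbrs_def)
next
  case False
  have l: "length Y = k" "length Y' = k" using Y Y' tern_words_length by auto
  obtain i where i: "i < k" "Y ! i \<noteq> Y' ! i" using False l by (auto simp: list_eq_iff_nth_eq)
  define Q where "Q = Y'[i := Y ! i]"
  have Q: "Q \<in> nbrs k Y'" unfolding nbrs_def
    using differ_one_update[of i Y' "Y ! i"] i l tern_words_update[OF Y'] tern_words_nth[OF Y i(1)]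
    by (auto simp: Q_def)
  have "W = Q" if "W \<in> box Y Q" "W \<in> clnbrs k Y'" for W
  proof -
    have Wi: "W ! i = Y ! i" using that(1) i l by (auto simp: box_def Q_def)
    then have "differ_one Y' W" using that(2) i by (auto simp: clnbrs_def nbrs_def)
    then obtain j c where "j < length Y'" "W = Y'[j := c]" by (auto elim: differ_oneE)
    then show ?thesis using Wi i unfolding Q_def by (cases "i = j") auto
  qed
  moreover have "Q \<in> box Y Q" using l by (auto simp: box_def Q_def)
  moreover have "Q \<noteq> Y'" using Q by (auto simp: nbrs_def)
  ultimately show ?thesis using False Q by (intro that[of Q]) (auto simp: clnbrs_def)
qed

section \<open>Disjoint paths in the exchanged 3-ary cube\<close>

lemma E3C_E_sym: "E3C_E x y \<Longrightarrow> E3C_E y x"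
  unfolding E3C_E_def by (auto dest: differ_one_sym split: prod.splits)

lemma E3C_E_layer: "d \<noteq> d' \<Longrightarrow> E3C_E (A, B, C, d) (A, B, C, d')"
  by (auto simp: E3C_E_def)

lemma E3C_E_A: "differ_one A A' \<Longrightarrow> E3C_E (A, B, C, 2) (A', B, C, 2)"
  by (auto simp: E3C_E_def)

lemma E3C_E_B: "differ_one B B' \<Longrightarrow> E3C_E (A, B, C, 1) (A, B', C, 1)"
  by (auto simp: E3C_E_def)

lemma E3C_E_C: "differ_one C C' \<Longrightarrow> E3C_E (A, B, C, 0) (A, B, C', 0)"
  by (auto simp: E3C_E_def)

lemma E3C_V_iff [simp]: "(A, B, C, d) \<in> E3C_V r s t \<longleftrightarrow>
    A \<in> tern_words r \<and> B \<in> tern_words s \<and> C \<in> tern_words t \<and> d \<in> {0, 1, 2}"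
  by (simp add: E3C_V_def)

lemma conn_layer:
  "(A, B, C, d) \<in> S \<Longrightarrow> (A, B, C, d') \<in> S \<Longrightarrow> d \<noteq> d' \<Longrightarrow> conn E3C_E S (Suc 0) (A, B, C, d) (A, B, C, d')"
  by (simp add: conn_edge E3C_E_layer)

lemma conn_A:
  assumes "A \<in> tern_words r" "A' \<in> tern_words r" "tern_words r \<times> {B} \<times> {C} \<times> {2} \<subseteq> S"
  shows "conn E3C_E S r (A, B, C, 2) (A', B, C, 2)"
proof -
  have "conn E3C_E S (ham A A') (A, B, C, 2) (A', B, C, 2)"
    using conn_ham[of A A' "\<lambda>A. (A, B, C, 2)" S E3C_E] assms box_subset_tern_words[OF assms(1,2)]
      tern_words_length[of A r] tern_words_length[of A' r] E3C_E_A by force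
  then show ?thesis using ham_le_length[of A A'] tern_words_length[OF assms(1)] by (auto intro: conn_mono)
qed

lemma conn_B_ham:
  assumes "B \<in> tern_words s" "B' \<in> tern_words s" "{A} \<times> box B B' \<times> {C} \<times> {1} \<subseteq> S"
  shows "conn E3C_E S (ham B B') (A, B, C, 1) (A, B', C, 1)"
  using conn_ham[of B B' "\<lambda>B. (A, B, C, 1)" S E3C_E] assms
    tern_words_length[of B s] tern_words_length[of B' s] E3C_E_B by force

lemma conn_B:
  assumes "B \<in> tern_words s" "B' \<in> tern_words s" "{A} \<times> box B B' \<times> {C} \<times> {1} \<subseteq> S"
  shows "conn E3C_E S s (A, B, C, 1) (A, B', C, 1)"
  using conn_B_ham[OF assms] ham_le_length[of B B'] tern_words_length[OF assms(1)]
  by (auto intro: conn_mono)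

lemma conn_C_ham:
  assumes "C \<in> tern_words t" "C' \<in> tern_words t" "{A} \<times> {B} \<times> tern_words t \<times> {0} \<subseteq> S"
  shows "conn E3C_E S (ham C C') (A, B, C, 0) (A, B, C', 0)"
  using conn_ham[of C C' "\<lambda>C. (A, B, C, 0)" S E3C_E] assms box_subset_tern_words[OF assms(1,2)]
      tern_words_length[of C t] tern_words_length[of C' t] E3C_E_C by force

lemma conn_C:
  assumes "C \<in> tern_words t" "C' \<in> tern_words t" "{A} \<times> {B} \<times> tern_words t \<times> {0} \<subseteq> S"
  shows "conn E3C_E S t (A, B, C, 0) (A, B, C', 0)"
  using conn_C_ham[OF assms] ham_le_length[of C C'] tern_words_length[OF assms(1)]
  by (auto intro: conn_mono)

section \<open>Routes between two ends given by their words\<close>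

locale e3c_pair =
  fixes r s t :: nat and X Y Z X' Y' Z' :: "nat list"
  assumes words: "X \<in> tern_words r" "Y \<in> tern_words s" "Z \<in> tern_words t"
      "X' \<in> tern_words r" "Y' \<in> tern_words s" "Z' \<in> tern_words t"
    and pos: "1 \<le> r" "1 \<le> s" "1 \<le> t"
begin

abbreviation "V \<equiv> E3C_V r s t"
abbreviation "u \<equiv> (X, Y, Z, 2::nat)"
text \<open>One less than the target \<open>r + s + t + 6\<close>, as a route does not count its
  first edge.\<close>

abbreviation "k \<equiv> r + s + t + 5"

lemma box_words: "W \<in> tern_words s \<Longrightarrow> W' \<in> tern_words s \<Longrightarrow> {A} \<times> tern_words s \<times> B \<subseteq> S \<Longrightarrow> {A} \<times> box W W' \<times> B \<subseteq> S"
  using box_subset_tern_words by fast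

text \<open>In the product sets below, a vertex in layer 2, 1, 0 may change its first, second, third word. The
  constraint \<open>Z1 \<noteq> Z, Z'\<close> moves the middle part of a detour to slices that no other route visits.\<close>
definition \<alpha>set :: "nat list \<Rightarrow> e3c_vertex set" where
  "\<alpha>set Z1 = {X} \<times> {Y} \<times> tern_words t \<times> {0} \<union> tern_words r \<times> {Y} \<times> {Z1} \<times> {2}
     \<union> {X'} \<times> tern_words s \<times> {Z1} \<times> {1} \<union> {X'} \<times> {Y'} \<times> tern_words t \<times> {0}"

text \<open>After the first edge there are four layer changes and at most
  \<open>r + s + (t + 1)\<close> letter changes, the extra one caused by the detour. The last layer
  change leaves layer 0, so it can enter layer 1 or layer 2.\<close>

lemma route_\<alpha>:
  assumes Z1: "Z1 \<in> tern_words t" "Z1 \<noteq> Z" "Z1 \<noteq> Z'" "ham Z Z1 + ham Z1 Z' \<le> Suc t"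
    and d: "d \<in> {1, 2}"
  shows "route E3C_E V u (X', Y', Z', d) k (\<alpha>set Z1)"
  unfolding route_def
proof
  show "\<alpha>set Z1 \<subseteq> V - {u, (X', Y', Z', d)}"
    using words Z1 d by (auto simp: \<alpha>set_def)
  let ?v = "(X', Y', Z', d)"
  let ?S = "insert ?v (\<alpha>set Z1)"
  have c1: "conn E3C_E ?S (ham Z Z1) (X, Y, Z, 0) (X, Y, Z1, 0)"
    by (rule conn_C_ham[OF words(3) Z1(1)]) (auto simp: \<alpha>set_def)
  have c2: "conn E3C_E ?S (Suc 0) (X, Y, Z1, 0) (X, Y, Z1, 2)"
    by (rule conn_layer) (use words Z1 in \<open>auto simp: \<alpha>set_def\<close>)
  have c3: "conn E3C_E ?S r (X, Y, Z1, 2) (X', Y, Z1, 2)"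
    by (rule conn_A[OF words(1,4)]) (auto simp: \<alpha>set_def)
  have c4: "conn E3C_E ?S (Suc 0) (X', Y, Z1, 2) (X', Y, Z1, 1)"
    by (rule conn_layer) (use words Z1 in \<open>auto simp: \<alpha>set_def\<close>)
  have c5: "conn E3C_E ?S s (X', Y, Z1, 1) (X', Y', Z1, 1)"
    by (rule conn_B[OF words(2,5)], rule box_words[OF words(2,5)]) (auto simp: \<alpha>set_def)
  have c6: "conn E3C_E ?S (Suc 0) (X', Y', Z1, 1) (X', Y', Z1, 0)"
    by (rule conn_layer) (use words Z1 in \<open>auto simp: \<alpha>set_def\<close>)
  have c7: "conn E3C_E ?S (ham Z1 Z') (X', Y', Z1, 0) (X', Y', Z', 0)"
    by (rule conn_C_ham[OF Z1(1) words(6)]) (auto simp: \<alpha>set_def)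
  have c8: "conn E3C_E ?S (Suc 0) (X', Y', Z', 0) ?v"
    by (rule conn_layer) (use words Z1 d in \<open>auto simp: \<alpha>set_def\<close>)
  have "conn E3C_E ?S k (X, Y, Z, 0) ?v"
    by (rule conn_mono[OF conn_trans[OF c1 conn_trans[OF c2 conn_trans[OF c3 conn_trans[OF c4
      conn_trans[OF c5 conn_trans[OF c6 conn_trans[OF c7 c8]]]]]]] order_refl]) (use Z1(4) in linarith)
  then show "\<exists>a\<in>\<alpha>set Z1. E3C_E u a \<and> conn E3C_E ?S k a ?v"
    using words by (intro bexI[of _ "(X, Y, Z, 0)"]) (auto simp: \<alpha>set_def E3C_E_layer)
qed

subsection \<open>Both ends in layer 2\<close>

text \<open>The counterpart of \<open>\<alpha>set\<close> with the detour in the second word. It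
  joins the layer 1 copies of both ends, while \<open>\<alpha>set\<close> joins their layer 0
  copies.\<close>

definition \<beta>set :: "nat list \<Rightarrow> e3c_vertex set" where
  "\<beta>set Y1 = {X} \<times> tern_words s \<times> {Z} \<times> {1} \<union> {X} \<times> {Y1} \<times> tern_words t \<times> {0}
     \<union> tern_words r \<times> {Y1} \<times> {Z'} \<times> {2} \<union> {X'} \<times> tern_words s \<times> {Z'} \<times> {1}"

lemma route_\<beta>:
  assumes Y1: "Y1 \<in> tern_words s" "Y1 \<noteq> Y" "Y1 \<noteq> Y'" "ham Y Y1 + ham Y1 Y' \<le> Suc s"
  shows "route E3C_E V u (X', Y', Z', 2) k (\<beta>set Y1)"
  unfolding route_def
proof
  show "\<beta>set Y1 \<subseteq> V - {u, (X', Y', Z', 2)}"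
    using words Y1 by (auto simp: \<beta>set_def)
  let ?v = "(X', Y', Z', 2)"
  let ?S = "insert ?v (\<beta>set Y1)"
  have c1: "conn E3C_E ?S (ham Y Y1) (X, Y, Z, 1) (X, Y1, Z, 1)"
    by (rule conn_B_ham[OF words(2) Y1(1)], rule box_words[OF words(2) Y1(1)]) (auto simp: \<beta>set_def)
  have c2: "conn E3C_E ?S (Suc 0) (X, Y1, Z, 1) (X, Y1, Z, 0)"
    by (rule conn_layer) (use words Y1 in \<open>auto simp: \<beta>set_def\<close>)
  have c3: "conn E3C_E ?S t (X, Y1, Z, 0) (X, Y1, Z', 0)"
    by (rule conn_C[OF words(3,6)]) (auto simp: \<beta>set_def)
  have c4: "conn E3C_E ?S (Suc 0) (X, Y1, Z', 0) (X, Y1, Z', 2)"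
    by (rule conn_layer) (use words Y1 in \<open>auto simp: \<beta>set_def\<close>)
  have c5: "conn E3C_E ?S r (X, Y1, Z', 2) (X', Y1, Z', 2)"
    by (rule conn_A[OF words(1,4)]) (auto simp: \<beta>set_def)
  have c6: "conn E3C_E ?S (Suc 0) (X', Y1, Z', 2) (X', Y1, Z', 1)"
    by (rule conn_layer) (use words Y1 in \<open>auto simp: \<beta>set_def\<close>)
  have c7: "conn E3C_E ?S (ham Y1 Y') (X', Y1, Z', 1) (X', Y', Z', 1)"
    by (rule conn_B_ham[OF Y1(1) words(5)], rule box_words[OF Y1(1) words(5)]) (auto simp: \<beta>set_def)
  have c8: "conn E3C_E ?S (Suc 0) (X', Y', Z', 1) ?v"
    by (rule conn_layer) (use words Y1 in \<open>auto simp: \<beta>set_def\<close>)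
  have "conn E3C_E ?S k (X, Y, Z, 1) ?v"
    by (rule conn_mono[OF conn_trans[OF c1 conn_trans[OF c2 conn_trans[OF c3 conn_trans[OF c4
      conn_trans[OF c5 conn_trans[OF c6 conn_trans[OF c7 c8]]]]]]] order_refl]) (use Y1(4) in linarith)
  then show "\<exists>a\<in>\<beta>set Y1. E3C_E u a \<and> conn E3C_E ?S k a ?v"
    using words by (intro bexI[of _ "(X, Y, Z, 1)"]) (auto simp: \<beta>set_def E3C_E_layer)
qed

text \<open>Replaces \<open>\<alpha>set\<close> when \<open>X\<close> and \<open>X'\<close> are adjacent: then \<open>pset X'\<close> already ends in
  the neighbour \<open>(X', Y', Z', 0)\<close> of the target, and \<open>(X, Y', Z', 2)\<close> is free.\<close>
definition \<gamma>set :: "nat list \<Rightarrow> e3c_vertex set" where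
  "\<gamma>set Z1 = {X} \<times> {Y} \<times> tern_words t \<times> {0} \<union> {X} \<times> tern_words s \<times> {Z1} \<times> {1}
     \<union> {X} \<times> {Y'} \<times> tern_words t \<times> {0} \<union> {X} \<times> {Y'} \<times> {Z'} \<times> {2}"

text \<open>The last edge changes \<open>X\<close> to \<open>X'\<close> in layer 2. The condition
  \<open>Z \<noteq> Z'\<close> keeps its start \<open>(X, Y', Z', 2)\<close> different from
  \<open>u\<close>.\<close>

lemma route_\<gamma>:
  assumes Z1: "Z1 \<in> tern_words t" "Z1 \<noteq> Z" "Z1 \<noteq> Z'" "ham Z Z1 + ham Z1 Z' \<le> Suc t"
    and adj: "differ_one X X'" and "Z \<noteq> Z'"
  shows "route E3C_E V u (X', Y', Z', 2) k (\<gamma>set Z1)"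
  unfolding route_def
proof
  show "\<gamma>set Z1 \<subseteq> V - {u, (X', Y', Z', 2)}"
    using words Z1 adj \<open>Z \<noteq> Z'\<close> by (auto simp: \<gamma>set_def)
  let ?v = "(X', Y', Z', 2)"
  let ?S = "insert ?v (\<gamma>set Z1)"
  have c1: "conn E3C_E ?S (ham Z Z1) (X, Y, Z, 0) (X, Y, Z1, 0)"
    by (rule conn_C_ham[OF words(3) Z1(1)]) (auto simp: \<gamma>set_def)
  have c2: "conn E3C_E ?S (Suc 0) (X, Y, Z1, 0) (X, Y, Z1, 1)"
    by (rule conn_layer) (use words Z1 in \<open>auto simp: \<gamma>set_def\<close>)
  have c3: "conn E3C_E ?S s (X, Y, Z1, 1) (X, Y', Z1, 1)"
    by (rule conn_B[OF words(2,5)], rule box_words[OF words(2,5)]) (auto simp: \<gamma>set_def)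
  have c4: "conn E3C_E ?S (Suc 0) (X, Y', Z1, 1) (X, Y', Z1, 0)"
    by (rule conn_layer) (use words Z1 in \<open>auto simp: \<gamma>set_def\<close>)
  have c5: "conn E3C_E ?S (ham Z1 Z') (X, Y', Z1, 0) (X, Y', Z', 0)"
    by (rule conn_C_ham[OF Z1(1) words(6)]) (auto simp: \<gamma>set_def)
  have c6: "conn E3C_E ?S (Suc 0) (X, Y', Z', 0) (X, Y', Z', 2)"
    by (rule conn_layer) (use words Z1 in \<open>auto simp: \<gamma>set_def\<close>)
  have c7: "conn E3C_E ?S (Suc 0) (X, Y', Z', 2) ?v"
    by (rule conn_edge) (use E3C_E_A[OF adj] in \<open>auto simp: \<gamma>set_def\<close>)
  have "conn E3C_E ?S k (X, Y, Z, 0) ?v"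
    by (rule conn_mono[OF conn_trans[OF c1 conn_trans[OF c2 conn_trans[OF c3 conn_trans[OF c4
      conn_trans[OF c5 conn_trans[OF c6 c7]]]]]] order_refl]) (use Z1(4) in linarith)
  then show "\<exists>a\<in>\<gamma>set Z1. E3C_E u a \<and> conn E3C_E ?S k a ?v"
    using words by (intro bexI[of _ "(X, Y, Z, 0)"]) (auto simp: \<gamma>set_def E3C_E_layer)
qed

definition pset :: "nat list \<Rightarrow> e3c_vertex set" where
  "pset P = {P} \<times> {Y} \<times> {Z} \<times> {2} \<union> {P} \<times> tern_words s \<times> {Z} \<times> {1}
     \<union> {P} \<times> {Y'} \<times> tern_words t \<times> {0} \<union> fan r X X' P \<times> {Y'} \<times> {Z'} \<times> {2}"

text \<open>\<open>ne\<close> says that \<open>(P, Y, Z, 2)\<close> is not already the target. For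
  \<open>P = X'\<close> the fan is empty and the target is entered from
  \<open>(X', Y', Z', 0)\<close>.\<close>

lemma route_pset:
  assumes P: "P \<in> nbrs r X" and ne: "P \<noteq> X' \<or> Y \<noteq> Y' \<or> Z \<noteq> Z'"
  shows "route E3C_E V u (X', Y', Z', 2) k (pset P)"
  unfolding route_def
proof
  note fan = fan_properties[OF words(1,4) P]
  have PX: "P \<in> tern_words r" "differ_one X P" "P \<noteq> X" using P by (auto simp: nbrs_def)
  show "pset P \<subseteq> V - {u, (X', Y', Z', 2)}"
    using words PX ne fan(1-3) by (auto simp: pset_def)
  let ?v = "(X', Y', Z', 2)"
  let ?S = "insert ?v (pset P)"
  have c1: "conn E3C_E ?S (Suc 0) (P, Y, Z, 2) (P, Y, Z, 1)"
    by (rule conn_layer) (use words in \<open>auto simp: pset_def\<close>)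
  have c2: "conn E3C_E ?S s (P, Y, Z, 1) (P, Y', Z, 1)"
    by (rule conn_B[OF words(2,5)], rule box_words[OF words(2,5)]) (auto simp: pset_def)
  have c3: "conn E3C_E ?S (Suc 0) (P, Y', Z, 1) (P, Y', Z, 0)"
    by (rule conn_layer) (use words in \<open>auto simp: pset_def\<close>)
  have c4: "conn E3C_E ?S t (P, Y', Z, 0) (P, Y', Z', 0)"
    by (rule conn_C[OF words(3,6)]) (auto simp: pset_def)
  have c5: "conn E3C_E ?S (Suc 0) (P, Y', Z', 0) (P, Y', Z', 2)"
    by (rule conn_layer) (use words fan(6) in \<open>auto simp: pset_def\<close>)
  have c6: "conn E3C_E ?S r (P, Y', Z', 2) ?v"
    by (rule conn_map[where f = "\<lambda>W. (W, Y', Z', 2)" and E = differ_one, OF fan(4)])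
      (auto simp: pset_def E3C_E_A)
  have "conn E3C_E ?S k (P, Y, Z, 2) ?v"
    by (rule conn_mono[OF conn_trans[OF c1 conn_trans[OF c2 conn_trans[OF c3 conn_trans[OF c4
      conn_trans[OF c5 c6]]]]] order_refl]) linarith
  then show "\<exists>a\<in>pset P. E3C_E u a \<and> conn E3C_E ?S k a ?v"
    by (intro bexI[of _ "(P, Y, Z, 2)"]) (auto simp: pset_def E3C_E_A PX)
qed

lemma pset_disjoint:
  assumes "P \<in> nbrs r X" "Q \<in> nbrs r X" "P \<noteq> Q"
    "P \<noteq> X' \<or> Y \<noteq> Y' \<or> Z \<noteq> Z'" "Q \<noteq> X' \<or> Y \<noteq> Y' \<or> Z \<noteq> Z'"
  shows "pset P \<inter> pset Q = {}"
  using fan_properties(5)[OF words(1,4) assms(1) assms(2,3)] assms(3-5)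
    fan_properties(6)[OF words(1,4) assms(1)] fan_properties(6)[OF words(1,4) assms(2)]
  unfolding pset_def by auto

text \<open>Without adjacency of \<open>X\<close> and \<open>X'\<close>, all \<open>2 * r\<close>
  sets \<open>pset P\<close> are joined by \<open>\<beta>set\<close> and \<open>\<alpha>set\<close>.
  With adjacency and \<open>Z \<noteq> Z'\<close>, \<open>\<gamma>set\<close> replaces
  \<open>\<alpha>set\<close>. If the ends themselves are adjacent, their edge replaces
  \<open>pset X'\<close>. Condition \<open>c\<close> leaves out adjacent \<open>X\<close>,
  \<open>X'\<close> with \<open>Z = Z'\<close> and \<open>Y \<noteq> Y'\<close>, where second and
  third word can be exchanged.\<close>

lemma linkable_22:
  assumes ne: "u \<noteq> (X', Y', Z', 2)"
    and c: "differ_one X X' \<Longrightarrow> Z \<noteq> Z' \<or> (Y = Y' \<and> Z = Z')"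
  shows "linkable V E3C_E (2 * r + 2) (r + s + t + 6) u (X', Y', Z', 2)"
proof -
  let ?v = "(X', Y', Z', 2)"
  obtain Z1 where Z1: "Z1 \<in> tern_words t" "Z1 \<noteq> Z" "Z1 \<noteq> Z'" "ham Z Z1 + ham Z1 Z' \<le> Suc t"
    using detour_word[OF words(3,6) pos(3)] by metis
  obtain Y1 where Y1: "Y1 \<in> tern_words s" "Y1 \<noteq> Y" "Y1 \<noteq> Y'" "ham Y Y1 + ham Y1 Y' \<le> Suc s"
    using detour_word[OF words(2,5) pos(2)] by metis
  have uv: "u \<in> V" "?v \<in> V" using words by auto
  have cn: "card (nbrs r X) = 2 * r" using card_nbrs words by blast
  have PX: "P \<noteq> X" if "P \<in> nbrs r X" for P using that by (auto simp: nbrs_def)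
  have XF: "X \<notin> fan r X X' P" if "P \<in> nbrs r X" for P
    using fan_properties(2)[OF words(1,4) that] .
  show ?thesis
  proof (cases "differ_one X X' \<and> Z \<noteq> Z'")
    case True
    have R: "routing E3C_E V u ?v k (2 * r) (\<Union>P\<in>nbrs r X. pset P)"
      unfolding cn[symmetric] by (rule routing_family) (use True pset_disjoint in \<open>auto intro: route_pset\<close>)
    have R: "routing E3C_E V u ?v k (Suc (2 * r)) ((\<Union>P\<in>nbrs r X. pset P) \<union> \<beta>set Y1)"
      by (rule routing_insert[OF R route_\<beta>[OF Y1]])
        (use True Y1 in \<open>auto simp: pset_def \<beta>set_def dest: PX\<close>)
    have R: "routing E3C_E V u ?v k (Suc (Suc (2 * r))) ((\<Union>P\<in>nbrs r X. pset P) \<union> \<beta>set Y1 \<union> \<gamma>set Z1)"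
      by (rule routing_insert[OF R route_\<gamma>[OF Z1]])
        (use True Y1 Z1 in \<open>auto simp: pset_def \<beta>set_def \<gamma>set_def dest: PX XF\<close>)
    show ?thesis using routing_imp_linkable(1)[OF R uv ne] by (simp add: add.commute)
  next
    case False
    define N where "N = nbrs r X - {X'}"
    have R: "routing E3C_E V u ?v k (card N) (\<Union>P\<in>N. pset P)"
      by (rule routing_family) (use pset_disjoint in \<open>auto intro: route_pset simp: N_def\<close>)
    have R: "routing E3C_E V u ?v k (Suc (card N)) ((\<Union>P\<in>N. pset P) \<union> \<beta>set Y1)"
      by (rule routing_insert[OF R route_\<beta>[OF Y1]])
        (use Y1 in \<open>auto simp: pset_def \<beta>set_def N_def dest: PX\<close>)
    have R: "routing E3C_E V u ?v k (Suc (Suc (card N))) ((\<Union>P\<in>N. pset P) \<union> \<beta>set Y1 \<union> \<alpha>set Z1)"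
      by (rule routing_insert[OF R route_\<alpha>[OF Z1]])
        (use Y1 Z1 in \<open>auto simp: pset_def \<beta>set_def \<alpha>set_def N_def dest: PX\<close>)
    show ?thesis
    proof (cases "differ_one X X'")
      case False
      then have "N = nbrs r X" by (auto simp: N_def nbrs_def)
      then show ?thesis using routing_imp_linkable(1)[OF R uv ne] cn by (simp add: add.commute)
    next
      case True
      then have "Y = Y'" "Z = Z'" using False c by auto
      then have "E3C_E u ?v" using E3C_E_A[OF True] by simp
      moreover have "Suc (card N) = 2 * r"
        using True words(4) cn card_Suc_Diff1[of "nbrs r X" X'] by (simp add: N_def nbrs_def[of r X] finite_tern_words)
      ultimately show ?thesis using routing_imp_linkable(2)[OF R uv ne] by (simp add: add.commute)
    qed
  qed
qed

subsection \<open>Ends in layers 2 and 1\<close>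

abbreviation "v1 \<equiv> (X', Y', Z', 1::nat)"

text \<open>The route through the neighbours given by \<open>P\<close> and \<open>Q\<close> of the two ends; \<open>P = X\<close> and \<open>Q = Y'\<close>
  stand for the layer changes at the ends. Routes for different \<open>P\<close> and different \<open>Q\<close> are disjoint,
  so a matching of closed neighbourhoods gives all routes but one.\<close>
definition qset :: "nat list \<Rightarrow> nat list \<Rightarrow> e3c_vertex set" where
  "qset P Q = ({P} \<times> {Y} \<times> {Z} \<times> {2} \<union> {P} \<times> tern_words s \<times> {Z} \<times> {1}
     \<union> {P} \<times> {Q} \<times> tern_words t \<times> {0} \<union> tern_words r \<times> {Q} \<times> {Z'} \<times> {2}
     \<union> {X'} \<times> {Q} \<times> {Z'} \<times> {1}) - {u, v1}"

text \<open>If \<open>Z = Z'\<close>, the layer 1 part for \<open>P = X'\<close> could run through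
  \<open>v1\<close>, and the layer 2 part for \<open>Q = Y\<close> through \<open>u\<close>;
  \<open>ne\<close> prevents both.\<close>

lemma route_qset:
  assumes P: "P \<in> clnbrs r X" and Q: "Q \<in> clnbrs s Y'" and ne: "Z \<noteq> Z' \<or> (P \<noteq> X' \<and> Q \<noteq> Y)"
  shows "route E3C_E V u v1 k (qset P Q)"
  unfolding route_def
proof
  have PQ: "P \<in> tern_words r" "Q \<in> tern_words s" using P Q clnbrs_subset words by auto
  show "qset P Q \<subseteq> V - {u, v1}" using words PQ by (auto simp: qset_def)
  let ?S = "insert v1 (qset P Q)"
  have c1: "conn E3C_E ?S s (P, Y, Z, 1) (P, Q, Z, 1)"
    by (rule conn_B[OF words(2) PQ(2)], rule box_words[OF words(2) PQ(2)]) (auto simp: qset_def)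
  have c2: "conn E3C_E ?S (Suc 0) (P, Q, Z, 1) (P, Q, Z, 0)"
    by (rule conn_layer) (use words PQ in \<open>auto simp: qset_def\<close>)
  have c3: "conn E3C_E ?S t (P, Q, Z, 0) (P, Q, Z', 0)"
    by (rule conn_C[OF words(3,6)]) (auto simp: qset_def)
  have c4: "conn E3C_E ?S (Suc 0) (P, Q, Z', 0) (P, Q, Z', 2)"
    by (rule conn_layer) (use words PQ ne in \<open>auto simp: qset_def\<close>)
  have c5: "conn E3C_E ?S r (P, Q, Z', 2) (X', Q, Z', 2)"
    by (rule conn_A[OF PQ(1) words(4)]) (use ne in \<open>auto simp: qset_def\<close>)
  have c6: "conn E3C_E ?S 2 (X', Q, Z', 2) v1"
  proof (cases "Q = Y'")
    case True
    have "conn E3C_E ?S (Suc 0) (X', Q, Z', 2) v1"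
      unfolding True by (rule conn_layer) (use words ne True in \<open>auto simp: qset_def\<close>)
    then show ?thesis by (rule conn_mono) auto
  next
    case False
    have 1: "conn E3C_E ?S (Suc 0) (X', Q, Z', 2) (X', Q, Z', 1)"
      by (rule conn_layer) (use words ne in \<open>auto simp: qset_def\<close>)
    have "differ_one Q Y'" using False Q differ_one_sym by (auto simp: clnbrs_def nbrs_def)
    then have "conn E3C_E ?S (Suc 0) (X', Q, Z', 1) v1"
      by (intro conn_edge E3C_E_B) (auto simp: qset_def)
    from conn_trans[OF 1 this] show ?thesis by (simp add: numeral_2_eq_2)
  qed
  have c: "conn E3C_E ?S (r + s + t + 4) (P, Y, Z, 1) v1"
    by (rule conn_mono[OF conn_trans[OF c1 conn_trans[OF c2 conn_trans[OF c3 conn_trans[OF c4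
      conn_trans[OF c5 c6]]]]] order_refl]) linarith
  show "\<exists>a\<in>qset P Q. E3C_E u a \<and> conn E3C_E ?S k a v1"
  proof (cases "P = X")
    case True
    have "conn E3C_E ?S k (P, Y, Z, 1) v1" by (rule conn_mono[OF c]) auto
    then show ?thesis using True words ne
      by (intro bexI[of _ "(P, Y, Z, 1)"]) (auto simp: qset_def E3C_E_layer)
  next
    case False
    have "conn E3C_E ?S (Suc 0) (P, Y, Z, 2) (P, Y, Z, 1)"
      by (rule conn_layer) (use False words in \<open>auto simp: qset_def\<close>)
    then have "conn E3C_E ?S k (P, Y, Z, 2) v1" by (rule conn_mono[OF conn_trans[OF _ c]]) auto
    moreover have "differ_one X P" using False P by (auto simp: clnbrs_def nbrs_def)
    ultimately show ?thesis using False
      by (intro bexI[of _ "(P, Y, Z, 2)"]) (auto simp: qset_def E3C_E_A)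
  qed
qed

text \<open>Each of the five pieces fixes \<open>P\<close> or \<open>Q\<close>. A piece fixing
  \<open>P\<close> can meet one fixing \<open>Q'\<close> only if \<open>Z = Z'\<close>, in layer 2
  with \<open>Q' = Y\<close> or in layer 1 with \<open>P = X'\<close>.\<close>

lemma qset_disjoint:
  assumes "P \<noteq> P'" "Q \<noteq> Q'"
    and "Z \<noteq> Z' \<or> (P \<noteq> X' \<and> Q \<noteq> Y \<and> P' \<noteq> X' \<and> Q' \<noteq> Y)"
  shows "qset P Q \<inter> qset P' Q' = {}"
  using assms unfolding qset_def by auto

text \<open>In layers 1 and 2 the third words differ. In layer 0, \<open>\<alpha>set Z1\<close>
  occupies just the lines over \<open>(X, Y)\<close> and \<open>(X', Y')\<close>.\<close>

lemma qset_\<alpha>_disjoint: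
  assumes "Z1 \<noteq> Z" "Z1 \<noteq> Z'" "(P, Q) \<noteq> (X, Y)" "(P, Q) \<noteq> (X', Y')"
  shows "qset P Q \<inter> \<alpha>set Z1 = {}"
  using assms unfolding qset_def \<alpha>set_def by auto

lemma routing_matching:
  assumes D: "finite D" "D \<subseteq> clnbrs r X" "inj_on \<phi> D" "\<phi> ` D \<subseteq> clnbrs s Y'"
    and ne: "Z \<noteq> Z' \<and> (\<forall>P\<in>D. (P, \<phi> P) \<noteq> (X, Y) \<and> (P, \<phi> P) \<noteq> (X', Y')) \<or> X' \<notin> D \<and> Y \<notin> \<phi> ` D"
    and Z1: "Z1 \<in> tern_words t" "Z1 \<noteq> Z" "Z1 \<noteq> Z'" "ham Z Z1 + ham Z1 Z' \<le> Suc t"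
  shows "routing E3C_E V u v1 k (Suc (card D)) ((\<Union>P\<in>D. qset P (\<phi> P)) \<union> \<alpha>set Z1)"
proof -
  have 1: "Z \<noteq> Z' \<or> (P \<noteq> X' \<and> \<phi> P \<noteq> Y)" if "P \<in> D" for P using ne that by auto
  have 2: "(P, \<phi> P) \<noteq> (X, Y)" "(P, \<phi> P) \<noteq> (X', Y')" if "P \<in> D" for P using ne that by auto
  have R: "routing E3C_E V u v1 k (card D) (\<Union>P\<in>D. qset P (\<phi> P))"
  proof (rule routing_family)
    show "route E3C_E V u v1 k (qset P (\<phi> P))" if "P \<in> D" for P
      using that D 1[OF that] by (intro route_qset) auto
    show "qset P (\<phi> P) \<inter> qset P' (\<phi> P') = {}" if "P \<in> D" "P' \<in> D" "P \<noteq> P'" for P P'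
      using that 1[OF that(1)] 1[OF that(2)] inj_onD[OF D(3), of P P'] by (intro qset_disjoint) auto
  qed (rule D)
  have "qset P (\<phi> P) \<inter> \<alpha>set Z1 = {}" if "P \<in> D" for P
    using that 2[OF that] Z1 by (intro qset_\<alpha>_disjoint)
  then show ?thesis by (intro routing_insert[OF R route_\<alpha>[OF Z1]]) auto
qed

text \<open>For \<open>Z \<noteq> Z'\<close> the \<open>2 * m + 1\<close> matched pairs avoid the
  two lines of \<open>\<alpha>set\<close>. For \<open>Z = Z'\<close> they must avoid
  \<open>X'\<close> and \<open>Y\<close> altogether, which is automatic in the second case; in the
  third, \<open>2 * m\<close> pairs are matched and a direct route or edge inside the slice
  \<open>Z\<close> is added.\<close>

lemma linkable_21:
  assumes m: "1 \<le> m" "m \<le> r" "m \<le> s"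
    and c: "Z \<noteq> Z' \<or> X' \<in> clnbrs r X \<or> Y \<notin> clnbrs s Y'"
  shows "linkable V E3C_E (2 * m + 2) (r + s + t + 6) u v1"
proof -
  obtain Z1 where Z1: "Z1 \<in> tern_words t" "Z1 \<noteq> Z" "Z1 \<noteq> Z'" "ham Z Z1 + ham Z1 Z' \<le> Suc t"
    using detour_word[OF words(3,6) pos(3)] by metis
  have uv: "u \<in> V" "v1 \<in> V" "u \<noteq> v1" using words by auto
  have card: "card (clnbrs r X) = Suc (2 * r)" "card (clnbrs s Y') = Suc (2 * s)"
    and fin: "finite (clnbrs r X)" "finite (clnbrs s Y')"
    using card_clnbrs words by (auto simp: clnbrs_def)
  consider "Z \<noteq> Z'" | "Z = Z'" "X' \<notin> clnbrs r X" "Y \<notin> clnbrs s Y'" | "Z = Z'" "X' \<in> clnbrs r X"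
    using c by blast
  then show ?thesis
  proof cases
    case 1
    obtain D \<phi> where D: "D \<subseteq> clnbrs r X" "card D = Suc (2 * m)" "finite D" "inj_on \<phi> D"
      "\<phi> ` D \<subseteq> clnbrs s Y'" "\<And>x. x \<in> D \<Longrightarrow> (x, \<phi> x) \<noteq> (X, Y) \<and> (x, \<phi> x) \<noteq> (X', Y')"
      using matching_avoiding[OF fin, of "Suc (2 * m)" X Y X' Y'] card m by auto
    have "routing E3C_E V u v1 k (Suc (card D)) ((\<Union>P\<in>D. qset P (\<phi> P)) \<union> \<alpha>set Z1)"
      by (rule routing_matching[OF D(3,1,4,5) _ Z1]) (use D(6) 1 in blast)
    from routing_imp_linkable(1)[OF this uv] show ?thesis using D(2) by (simp add: add.commute)
  next
    case 2
    obtain D \<phi> where D: "D \<subseteq> clnbrs r X" "card D = Suc (2 * m)" "finite D" "inj_on \<phi> D"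
      "\<phi> ` D \<subseteq> clnbrs s Y'"
      using matching_exists[OF fin, of "Suc (2 * m)"] card m by auto
    have "routing E3C_E V u v1 k (Suc (card D)) ((\<Union>P\<in>D. qset P (\<phi> P)) \<union> \<alpha>set Z1)"
      by (rule routing_matching[OF D(3,1,4,5) _ Z1]) (use D 2 in blast)
    from routing_imp_linkable(1)[OF this uv] show ?thesis using D(2) by (simp add: add.commute)
  next
    case 3
    obtain Q where Q: "Q \<in> clnbrs s Y'" "box Y Q \<inter> clnbrs s Y' = {Q}" "Y = Y' \<longleftrightarrow> Q = Y'"
      using last_letter_word[OF words(2,5)] by metis
    have Qw: "Q \<in> tern_words s" using Q(1) clnbrs_subset words by blast
    have Yb: "Y \<in> box Y Q" by (simp add: box_def)
    have Qb: "Q \<in> box Y Q" using Q(2) by blast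
    have bw: "box Y Q \<subseteq> tern_words s" using box_subset_tern_words[OF words(2) Qw] .
    obtain D \<phi> where D: "D \<subseteq> clnbrs r X - {X'}" "card D = 2 * m" "finite D" "inj_on \<phi> D"
      "\<phi> ` D \<subseteq> clnbrs s Y' - {Q}"
      using matching_exists[of "clnbrs r X - {X'}" "clnbrs s Y' - {Q}" "2 * m"] card m fin 3 Q(1) by auto
    have \<phi>: "\<phi> P \<notin> box Y Q" "P \<noteq> X'" if "P \<in> D" for P using D that Q(2) by auto
    have R: "routing E3C_E V u v1 k (Suc (card D)) ((\<Union>P\<in>D. qset P (\<phi> P)) \<union> \<alpha>set Z1)"
      by (rule routing_matching[OF D(3) _ D(4) _ _ Z1]) (use D \<phi> Yb in auto)
    show ?thesis
    proof (cases "X = X' \<and> Y = Y'")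
      case True
      then have "E3C_E u v1" using 3 by (simp add: E3C_E_layer)
      from routing_imp_linkable(2)[OF R uv this] show ?thesis using D(2) by (simp add: add.commute)
    next
      case False
      \<comment> \<open>The direct route changes \<open>X\<close> to \<open>X'\<close>, if they
        differ, and then \<open>Y\<close> to \<open>Q\<close> to \<open>Y'\<close> in layer 1. The
        restriction to \<open>box Y Q\<close> keeps it away from the ends
        \<open>(X', \<phi> P, Z', 1)\<close> of the other routes.\<close>
      define T where "T = ({X'} \<times> {Y} \<times> {Z} \<times> {2} \<union> {X'} \<times> box Y Q \<times> {Z} \<times> {1::nat}) - {u, v1}"
      have "T \<inter> ((\<Union>P\<in>D. qset P (\<phi> P)) \<union> \<alpha>set Z1) = {}"
        using \<phi> Yb Z1 unfolding T_def qset_def \<alpha>set_def by auto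
      moreover have "route E3C_E V u v1 k T"
        unfolding route_def
      proof
        show "T \<subseteq> V - {u, v1}" using words bw by (auto simp: T_def)
        let ?S = "insert v1 T"
        have c1: "conn E3C_E ?S (Suc s) (X', Y, Z, 1) v1"
        proof (cases "Y = Y'")
          case True
          then show ?thesis using 3 by (auto intro!: conn_refl)
        next
          case False
          then have "Q \<noteq> Y'" using Q by auto
          then have "differ_one Q Y'" using Q differ_one_sym by (auto simp: clnbrs_def nbrs_def)
          then have "E3C_E (X', Q, Z, 1) v1" using 3 E3C_E_B by simp
          then have 1: "conn E3C_E ?S (Suc 0) (X', Q, Z, 1) v1"
            using Qb by (intro conn_edge) (auto simp: T_def)
          have "conn E3C_E ?S s (X', Y, Z, 1) (X', Q, Z, 1)"
            by (rule conn_B[OF words(2) Qw]) (auto simp: T_def)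
          from conn_trans[OF this 1] show ?thesis by simp
        qed
        show "\<exists>a\<in>T. E3C_E u a \<and> conn E3C_E ?S k a v1"
        proof (cases "X = X'")
          case True
          have "conn E3C_E ?S k (X', Y, Z, 1) v1" by (rule conn_mono[OF c1]) auto
          then show ?thesis using True False Yb
            by (intro bexI[of _ "(X', Y, Z, 1)"]) (auto simp: T_def E3C_E_layer)
        next
          case F: False
          have "conn E3C_E ?S (Suc 0) (X', Y, Z, 2) (X', Y, Z, 1)"
            by (rule conn_layer) (use F Yb in \<open>auto simp: T_def\<close>)
          then have "conn E3C_E ?S k (X', Y, Z, 2) v1" by (rule conn_mono[OF conn_trans[OF _ c1]]) auto
          moreover have "differ_one X X'" using F 3 by (auto simp: clnbrs_def nbrs_def)
          ultimately show ?thesis using F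
            by (intro bexI[of _ "(X', Y, Z, 2)"]) (auto simp: T_def E3C_E_A)
        qed
      qed
      ultimately have "routing E3C_E V u v1 k (Suc (Suc (card D))) (((\<Union>P\<in>D. qset P (\<phi> P)) \<union> \<alpha>set Z1) \<union> T)"
        by (intro routing_insert[OF R])
      from routing_imp_linkable(1)[OF this uv] show ?thesis using D(2) by (simp add: add.commute)
    qed
  qed
qed

end

subsection \<open>Symmetries\<close>

text \<open>The digits name the exchanged layers. Layers 1 and 2 change the second and the first
  word, so exchanging both words and layers preserves edges.\<close>

definition swap12 :: "e3c_vertex \<Rightarrow> e3c_vertex" where
  "swap12 = (\<lambda>(A, B, C, d). (B, A, C, if d = 1 then 2 else if d = 2 then 1 else d))"

definition swap01 :: "e3c_vertex \<Rightarrow> e3c_vertex" where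
  "swap01 = (\<lambda>(A, B, C, d). (A, C, B, if d = 0 then 1 else if d = 1 then 0 else d))"

lemma swap12_swap12 [simp]: "swap12 (swap12 x) = x"
  by (cases x) (auto simp: swap12_def)

lemma swap01_swap01 [simp]: "swap01 (swap01 x) = x"
  by (cases x) (auto simp: swap01_def)

lemma swap12_V: "x \<in> E3C_V r s t \<Longrightarrow> swap12 x \<in> E3C_V s r t"
  by (cases x) (auto simp: swap12_def)

lemma swap01_V: "x \<in> E3C_V r s t \<Longrightarrow> swap01 x \<in> E3C_V r t s"
  by (cases x) (auto simp: swap01_def)

lemma swap12_E: "E3C_E x y \<Longrightarrow> E3C_E (swap12 x) (swap12 y)"
  by (cases x, cases y) (auto simp: swap12_def E3C_E_def split: if_splits)

lemma swap01_E: "E3C_E x y \<Longrightarrow> E3C_E (swap01 x) (swap01 y)"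
  by (cases x, cases y) (auto simp: swap01_def E3C_E_def split: if_splits)

lemma linkable_swap12:
  assumes "linkable (E3C_V s r t) E3C_E n k (swap12 u) (swap12 v)"
    and "u \<in> E3C_V r s t" "v \<in> E3C_V r s t"
  shows "linkable (E3C_V r s t) E3C_E n k u v"
proof -
  have "linkable (E3C_V r s t) E3C_E n k (swap12 (swap12 u)) (swap12 (swap12 v))"
  proof (rule linkable_map[OF assms(1)])
    show "inj_on swap12 S" for S by (rule inj_on_inverseI[of _ swap12]) simp
  qed (use assms(2,3) swap12_V swap12_E in blast)+
  then show ?thesis by simp
qed

lemma linkable_swap01:
  assumes "linkable (E3C_V r t s) E3C_E n k (swap01 u) (swap01 v)"
    and "u \<in> E3C_V r s t" "v \<in> E3C_V r s t"
  shows "linkable (E3C_V r s t) E3C_E n k u v"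
proof -
  have "linkable (E3C_V r s t) E3C_E n k (swap01 (swap01 u)) (swap01 (swap01 v))"
  proof (rule linkable_map[OF assms(1)])
    show "inj_on swap01 S" for S by (rule inj_on_inverseI[of _ swap01]) simp
  qed (use assms(2,3) swap01_V swap01_E in blast)+
  then show ?thesis by simp
qed

section \<open>Linking the ends for each pair of layers\<close>

lemma linkable_layers_22:
  assumes "1 \<le> m" "m \<le> r" "m \<le> s" "m \<le> t"
    and u: "(A, B, C, 2) \<in> E3C_V r s t" and v: "(A', B', C', 2) \<in> E3C_V r s t"
    and ne: "(A, B, C, 2) \<noteq> (A', B', C', 2::nat)"
  shows "linkable (E3C_V r s t) E3C_E (2 * m + 2) (r + s + t + 6) (A, B, C, 2) (A', B', C', 2)"
proof -
  interpret e3c_pair r s t A B C A' B' C' using assms by unfold_locales auto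
  interpret sw: e3c_pair r t s A C B A' C' B' using assms by unfold_locales auto
  have "linkable (E3C_V r s t) E3C_E (2 * r + 2) (r + s + t + 6) (A, B, C, 2) (A', B', C', 2)"
  proof (cases "C \<noteq> C' \<or> B = B'")
    case True
    then show ?thesis using linkable_22 ne by auto
  next
    case False
    have "linkable (E3C_V r t s) E3C_E (2 * r + 2) (r + t + s + 6) (A, C, B, 2) (A', C', B', 2)"
      by (rule sw.linkable_22) (use ne False in auto)
    then have "linkable (E3C_V r t s) E3C_E (2 * r + 2) (r + s + t + 6) (swap01 (A, B, C, 2)) (swap01 (A', B', C', 2))"
      by (simp add: swap01_def add_ac)
    then show ?thesis using linkable_swap01 u v by blast
  qed
  then show ?thesis using assms(2) by (auto intro: linkable_mono)
qed

text \<open>In the case left open by \<open>linkable_21\<close>, \<open>B\<close> lies in the closed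
  neighbourhood of \<open>B'\<close>. After \<open>swap12\<close> and reversal this is the condition
  on the first words. The common lower bound \<open>m\<close> makes the statement invariant under
  permuting the words.\<close>

lemma linkable_layers_21:
  assumes "1 \<le> m" "m \<le> r" "m \<le> s" "m \<le> t"
    and u: "(A, B, C, 2) \<in> E3C_V r s t" and v: "(A', B', C', 1) \<in> E3C_V r s t"
  shows "linkable (E3C_V r s t) E3C_E (2 * m + 2) (r + s + t + 6) (A, B, C, 2) (A', B', C', 1)"
proof -
  interpret e3c_pair r s t A B C A' B' C' using assms by unfold_locales auto
  interpret sw: e3c_pair s r t B' A' C' B A C using assms by unfold_locales auto
  show ?thesis
  proof (cases "C \<noteq> C' \<or> A' \<in> clnbrs r A \<or> B \<notin> clnbrs s B'")
    case True
    then show ?thesis using linkable_21 assms by auto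
  next
    case False
    have "linkable (E3C_V s r t) E3C_E (2 * m + 2) (s + r + t + 6) (B', A', C', 2) (B, A, C, 1)"
      by (rule sw.linkable_21) (use False assms in auto)
    then have "linkable (E3C_V s r t) E3C_E (2 * m + 2) (r + s + t + 6) (swap12 (A', B', C', 1)) (swap12 (A, B, C, 2))"
      by (simp add: swap12_def add_ac)
    from linkable_swap12[OF this v u] show ?thesis by (rule linkable_rev) (rule E3C_E_sym)
  qed
qed

lemma linkable_layers_20:
  assumes "1 \<le> m" "m \<le> r" "m \<le> s" "m \<le> t"
    and u: "(A, B, C, 2) \<in> E3C_V r s t" and v: "(A', B', C', 0) \<in> E3C_V r s t"
  shows "linkable (E3C_V r s t) E3C_E (2 * m + 2) (r + s + t + 6) (A, B, C, 2) (A', B', C', 0)"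
proof -
  have "linkable (E3C_V r t s) E3C_E (2 * m + 2) (r + t + s + 6) (A, C, B, 2) (A', C', B', 1)"
    by (rule linkable_layers_21) (use assms in auto)
  then have "linkable (E3C_V r t s) E3C_E (2 * m + 2) (r + s + t + 6) (swap01 (A, B, C, 2)) (swap01 (A', B', C', 0))"
    by (simp add: swap01_def add_ac)
  then show ?thesis using linkable_swap01 u v by blast
qed

lemma linkable_layers_10:
  assumes "1 \<le> m" "m \<le> r" "m \<le> s" "m \<le> t"
    and u: "(A, B, C, 1) \<in> E3C_V r s t" and v: "(A', B', C', 0) \<in> E3C_V r s t"
  shows "linkable (E3C_V r s t) E3C_E (2 * m + 2) (r + s + t + 6) (A, B, C, 1) (A', B', C', 0)"
proof -
  have "linkable (E3C_V s r t) E3C_E (2 * m + 2) (s + r + t + 6) (B, A, C, 2) (B', A', C', 0)"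
    by (rule linkable_layers_20) (use assms in auto)
  then have "linkable (E3C_V s r t) E3C_E (2 * m + 2) (r + s + t + 6) (swap12 (A, B, C, 1)) (swap12 (A', B', C', 0))"
    by (simp add: swap12_def add_ac)
  then show ?thesis using linkable_swap12 u v by blast
qed

lemma linkable_layers_11:
  assumes "1 \<le> m" "m \<le> r" "m \<le> s" "m \<le> t"
    and u: "(A, B, C, 1) \<in> E3C_V r s t" and v: "(A', B', C', 1) \<in> E3C_V r s t"
    and ne: "(A, B, C, 1) \<noteq> (A', B', C', 1::nat)"
  shows "linkable (E3C_V r s t) E3C_E (2 * m + 2) (r + s + t + 6) (A, B, C, 1) (A', B', C', 1)"
proof -
  have "linkable (E3C_V s r t) E3C_E (2 * m + 2) (s + r + t + 6) (B, A, C, 2) (B', A', C', 2)"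
    by (rule linkable_layers_22) (use assms in auto)
  then have "linkable (E3C_V s r t) E3C_E (2 * m + 2) (r + s + t + 6) (swap12 (A, B, C, 1)) (swap12 (A', B', C', 1))"
    by (simp add: swap12_def add_ac)
  then show ?thesis using linkable_swap12 u v by blast
qed

lemma linkable_layers_00:
  assumes "1 \<le> m" "m \<le> r" "m \<le> s" "m \<le> t"
    and u: "(A, B, C, 0) \<in> E3C_V r s t" and v: "(A', B', C', 0) \<in> E3C_V r s t"
    and ne: "(A, B, C, 0) \<noteq> (A', B', C', 0::nat)"
  shows "linkable (E3C_V r s t) E3C_E (2 * m + 2) (r + s + t + 6) (A, B, C, 0) (A', B', C', 0)"
proof -
  have "linkable (E3C_V r t s) E3C_E (2 * m + 2) (r + t + s + 6) (A, C, B, 1) (A', C', B', 1)"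
    by (rule linkable_layers_11) (use assms in auto)
  then have "linkable (E3C_V r t s) E3C_E (2 * m + 2) (r + s + t + 6) (swap01 (A, B, C, 0)) (swap01 (A', B', C', 0))"
    by (simp add: swap01_def add_ac)
  then show ?thesis using linkable_swap01 u v by blast
qed

theorem E3C_linkable:
  assumes m: "1 \<le> m" "m \<le> r" "m \<le> s" "m \<le> t"
    and u: "u \<in> E3C_V r s t" and v: "v \<in> E3C_V r s t" and ne: "u \<noteq> v"
  shows "linkable (E3C_V r s t) E3C_E (2 * m + 2) (r + s + t + 6) u v"
proof -
  obtain A B C d where uu: "u = (A, B, C, d)" by (cases u)
  obtain A' B' C' d' where vv: "v = (A', B', C', d')" by (cases v)
  have "d \<in> {0, 1, 2}" "d' \<in> {0, 1, 2}" using u v uu vv by auto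
  then consider "d = 2" "d' = 2" | "d = 1" "d' = 1" | "d = 0" "d' = 0" | "d = 2" "d' = 1"
    | "d = 2" "d' = 0" | "d = 1" "d' = 0" | "d' = 2" "d = 1" | "d' = 2" "d = 0" | "d' = 1" "d = 0"
    by blast
  then show ?thesis
  proof cases
    case 1 then show ?thesis using linkable_layers_22[OF m] u v ne uu vv by blast
  next
    case 2 then show ?thesis using linkable_layers_11[OF m] u v ne uu vv by blast
  next
    case 3 then show ?thesis using linkable_layers_00[OF m] u v ne uu vv by blast
  next
    case 4 then show ?thesis using linkable_layers_21[OF m] u v uu vv by blast
  next
    case 5 then show ?thesis using linkable_layers_20[OF m] u v uu vv by blast
  next
    case 6 then show ?thesis using linkable_layers_10[OF m] u v uu vv by blast
  next
    case 7
    show ?thesis unfolding uu vv 7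
      by (rule linkable_rev[OF linkable_layers_21[OF m] E3C_E_sym]) (use u v uu vv 7 in auto)
  next
    case 8
    show ?thesis unfolding uu vv 8
      by (rule linkable_rev[OF linkable_layers_20[OF m] E3C_E_sym]) (use u v uu vv 8 in auto)
  next
    case 9
    show ?thesis unfolding uu vv 9
      by (rule linkable_rev[OF linkable_layers_10[OF m] E3C_E_sym]) (use u v uu vv 9 in auto)
  qed
qed

section \<open>The lower bound\<close>

text \<open>Telescoping: \<open>h\<close> decreases by at most one per edge.\<close>

lemma gpath_potential:
  fixes h :: "'a \<Rightarrow> nat"
  assumes p: "gpath V E p u v" and h: "\<And>x y. x \<in> V \<Longrightarrow> y \<in> V \<Longrightarrow> E x y \<Longrightarrow> h x \<le> h y + 1"
  shows "h u \<le> h v + plen p"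
proof -
  have V: "p ! i \<in> V" if "i < length p" for i using p nth_mem[OF that] unfolding gpath_def by blast
  have *: "h (p ! 0) \<le> h (p ! i) + i" if "i < length p" for i
    using that
  proof (induction i)
    case (Suc i)
    then have "E (p ! i) (p ! Suc i)" using p by (simp add: gpath_def)
    then have "h (p ! i) \<le> h (p ! Suc i) + 1" using h V Suc by simp
    then show ?case using Suc by simp
  qed simp
  have "p \<noteq> []" "hd p = u" "last p = v" using p by (auto simp: gpath_def)
  then show ?thesis using *[of "length p - 1"] by (simp add: hd_conv_nth last_conv_nth plen_def)
qed

text \<open>A lower bound for the distance to \<open>(A', B', C', 2)\<close>: the summand that is added to the Hamming
  distances counts the layer changes that are still needed.\<close>
fun potential :: "nat list \<Rightarrow> nat list \<Rightarrow> nat list \<Rightarrow> e3c_vertex \<Rightarrow> nat" where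
  "potential A' B' C' (A, B, C, d) = ham A A' + ham B B' + ham C C' +
     (if d = 2 then (if B = B' \<and> C = C' then 0 else if B = B' \<or> C = C' then 2 else 3)
      else if d = 1 then (if C = C' then 1 else 2)
      else (if B = B' then 1 else 2))"

lemma ham_differ_one: "differ_one X Y \<Longrightarrow> ham X Z \<le> ham Y Z + 1"
  using ham_triangle[of X Y Z] by (simp add: differ_one_iff_ham)

text \<open>A letter change alters one Hamming distance by at most one and leaves the layer summand
  alone, since that summand ignores the word which the layer can change. A layer change alters only
  the summand, by at most one.\<close>

lemma potential_step:
  assumes "E3C_E x y" "x \<in> E3C_V r s t" "y \<in> E3C_V r s t"
  shows "potential A' B' C' x \<le> potential A' B' C' y + 1"
proof -
  obtain A B C d where x: "x = (A, B, C, d)" by (cases x)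
  obtain A1 B1 C1 d1 where y: "y = (A1, B1, C1, d1)" by (cases y)
  have d: "d \<in> {0, 1, 2}" "d1 \<in> {0, 1, 2}" using assms x y by auto
  from assms(1) consider "A = A1" "B = B1" "C = C1" "d \<noteq> d1"
    | "d = 0" "d1 = 0" "A = A1" "B = B1" "differ_one C C1"
    | "d = 1" "d1 = 1" "A = A1" "C = C1" "differ_one B B1"
    | "d = 2" "d1 = 2" "B = B1" "C = C1" "differ_one A A1"
    unfolding E3C_E_def x y by auto
  then show ?thesis
  proof cases
    case 1 then show ?thesis using d unfolding x y by auto
  next
    case 2 then show ?thesis using ham_differ_one[of C C1 C'] unfolding x y by auto
  next
    case 3 then show ?thesis using ham_differ_one[of B B1 B'] unfolding x y by auto
  next
    case 4 then show ?thesis using ham_differ_one[of A A1 A'] unfolding x y by auto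
  qed
qed

lemma ham_full: "(\<And>i. i < length X \<Longrightarrow> X ! i \<noteq> Y ! i) \<Longrightarrow> ham X Y = length X"
proof -
  assume "\<And>i. i < length X \<Longrightarrow> X ! i \<noteq> Y ! i"
  then have "{i. i < length X \<and> X ! i \<noteq> Y ! i} = {..<length X}" by auto
  then show ?thesis by (simp add: ham_def)
qed

lemma fault_diam_lower_bound:
  assumes "1 \<le> r" "1 \<le> s" "1 \<le> t"
  shows "enat (r + s + t + 4) \<le> fault_diam (E3C_V r s t) E3C_E (2 * r + 1)"
proof -
  let ?V = "E3C_V r s t"
  define X Y Z where "X = replicate r (0::nat)" and "Y = replicate s (0::nat)" and "Z = replicate t (0::nat)"
  define X' Y' Z' where "X' = replicate r (1::nat)" and "Y' = replicate s (1::nat)" and "Z' = replicate t (1::nat)"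
  \<comment> \<open>The letter 2 occurs in neither \<open>X\<close> nor \<open>X'\<close>, so the
    step to \<open>W\<close> brings no progress towards \<open>X'\<close>.\<close>
  define W where "W = X[0 := 2]"
  have words: "X \<in> tern_words r" "Y \<in> tern_words s" "Z \<in> tern_words t"
    "X' \<in> tern_words r" "Y' \<in> tern_words s" "Z' \<in> tern_words t"
    by (auto simp: X_def Y_def Z_def X'_def Y'_def Z'_def tern_words_def)
  define u v w where "u = (X, Y, Z, 2::nat)" and "v = (X', Y', Z', 2::nat)" and "w = (W, Y, Z, 2::nat)"
  define F where "F = {x \<in> ?V. E3C_E u x} - {w}"
  have nb: "{x \<in> ?V. E3C_E u x} = (\<lambda>P. (P, Y, Z, 2)) ` nbrs r X \<union> {(X, Y, Z, 0), (X, Y, Z, 1)}"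
    using words by (auto simp: u_def E3C_E_def nbrs_def)
  have fin: "finite {x \<in> ?V. E3C_E u x}" unfolding nb by simp
  have "card ((\<lambda>P. (P, Y, Z, 2::nat)) ` nbrs r X) = 2 * r"
    using card_nbrs[OF words(1)] by (simp add: card_image inj_on_def)
  then have "card {x \<in> ?V. E3C_E u x} = 2 * r + 2"
    unfolding nb by (subst card_Un_disjoint) auto
  moreover have W: "W \<in> nbrs r X"
    using differ_one_update[of 0 X 2] tern_words_update[OF words(1), of 2 0] assms
    by (simp add: W_def nbrs_def X_def)
  then have "w \<in> {x \<in> ?V. E3C_E u x}" unfolding nb w_def by auto
  ultimately have cF: "card F = 2 * r + 1" using fin by (simp add: F_def)
  have uv: "u \<in> ?V" "v \<in> ?V" "u \<noteq> v" using words assms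
    by (auto simp: u_def v_def Y_def Y'_def)
  have YZ: "Y \<noteq> Y'" "Z \<noteq> Z'" using assms by (auto simp: Y_def Y'_def Z_def Z'_def)
  then have F: "F \<subseteq> ?V - {u, v}" "finite F" using fin by (auto simp: F_def E3C_E_def u_def v_def)
  have "ham W X' = r" "ham Y Y' = s" "ham Z Z' = t"
    using ham_full[of W X'] ham_full[of Y Y'] ham_full[of Z Z'] assms
    by (auto simp: W_def X_def X'_def Y_def Y'_def Z_def Z'_def nth_list_update)
  \<comment> \<open>All \<open>r + s + t\<close> letters are wrong, and three layer changes are due:
    out of layer 2, between layers 0 and 1, and back.\<close>
  then have pot: "potential X' Y' Z' w = r + s + t + 3" "potential X' Y' Z' v = 0"
    using YZ by (auto simp: w_def v_def)
  have "r + s + t + 4 \<le> plen p" if p: "gpath (?V - F) E3C_E p u v" for p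
  proof -
    have l: "2 \<le> length p" using p uv(3) by (cases p rule: remdups_adj.cases) (auto simp: gpath_def)
    have p0: "p ! 0 = u" using p by (auto simp: gpath_def hd_conv_nth)
    have "E3C_E (p ! 0) (p ! (0 + 1))" using p l unfolding gpath_def by simp
    then have "E3C_E u (p ! 1)" using p0 by simp
    moreover have "p ! 1 \<in> ?V - F" using p l nth_mem[of 1 p] unfolding gpath_def by fastforce
    \<comment> \<open>All other neighbours of \<open>u\<close> are faults; the forced first step
      accounts for the last unit of \<open>r + s + t + 4\<close>.\<close>
    ultimately have p1: "p ! 1 = w" by (auto simp: F_def)
    have "gpath (?V - F) E3C_E (drop 1 p) w v" using gpath_drop[OF p, of 1] l p1 by simp
    then have "potential X' Y' Z' w \<le> potential X' Y' Z' v + plen (drop 1 p)"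
      by (rule gpath_potential) (use potential_step in blast)
    then show ?thesis using pot l by (simp add: plen_def)
  qed
  then have "enat (r + s + t + 4) \<le> gdist (?V - F) E3C_E u v"
    unfolding gdist_def by (auto intro!: Inf_greatest)
  also have "\<dots> \<le> fault_diam ?V E3C_E (2 * r + 1)"
    unfolding fault_diam_def using uv F cF by (intro Sup_upper) blast
  finally show ?thesis .
qed

theorem theorem3:
  fixes r s t n :: nat
  assumes "1 \<le> r" and "r \<le> s" and "s \<le> t" and "n = r + s + t + 1"
  shows "enat (n + 3) = enat (r + s + t + 4)
       \<and> enat (r + s + t + 4) \<le> fault_diam (E3C_V r s t) E3C_E (2 * r + 1)
       \<and> fault_diam (E3C_V r s t) E3C_E (2 * r + 1) \<le> wide_diam (E3C_V r s t) E3C_E (2 * r + 2)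
       \<and> wide_diam (E3C_V r s t) E3C_E (2 * r + 2) \<le> enat (r + s + t + 6)
       \<and> enat (r + s + t + 6) = enat (n + 5)"
proof -
  have "enat (r + s + t + 4) \<le> fault_diam (E3C_V r s t) E3C_E (2 * r + 1)"
    using assms by (intro fault_diam_lower_bound) auto
  moreover have "fault_diam (E3C_V r s t) E3C_E (2 * r + 1) \<le> wide_diam (E3C_V r s t) E3C_E (2 * r + 2)"
    using fault_diam_le_wide_diam[of "E3C_V r s t" E3C_E "2 * r + 1"] by simp
  \<comment> \<open>\<open>E3C_linkable\<close> is applied with \<open>m = r\<close>, the least of
    the three lengths.\<close>
  moreover have "wide_diam (E3C_V r s t) E3C_E (2 * r + 2) \<le> enat (r + s + t + 6)"
    by (rule wide_diam_le, rule E3C_linkable) (use assms in auto)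
  ultimately show ?thesis using assms(4) by auto
qed

end
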